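(* Let $n$ and $r$ be nonnegative integers, and let $G$ be an $(n+r+2)$-connected graph. If the isolated toughness of $G$ satisfies $I(G)>\frac{n+3(r+2)}{2(r+2)}$, then $G$ is $(P_{\geq3},n)$-factor critical avoidable; that is, for every $W\subseteq V(G)$ with $|W|=n$ and every edge $e\in E(G-W)$, the graph $G-W-e$ has a $P_{\geq 3}$-factor.
   Context: All graphs are finite, undirected and simple. For $X\subseteq V(G)$, $G-X$ deletes the vertices of $X$; $G-e$ deletes edge $e$. $i(G)$ denotes the number of isolated vertices of $G$. The isolated toughness of $G$ is $I(G)=+\infty$ if $G$ is complete, and otherwise $I(G)=\min\{|X|/i(G-X): X\subseteq V(G),\ i(G-X)\geq 2\}$. A path factor of $G$ is a spanning subgraph every component of which is a path of order at least 2; for an integer $k\geq2$, a $P_{\geq k}$-factor is a path factor each of whose components has at least $k$ vertices. $G$ is $P_{\geq k}$-factor avoidable if for every $e\in E(G)$, $G$ has a $P_{\geq k}$-factor not containing $e$. $G$ is $(P_{\geq k},n)$-factor critical avoidable if for every $W\subseteq V(G)$ with $|W|=n$, $G-W$ is $P_{\geq k}$-factor avoidable. *)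

theory Defs
  imports "Graph_Theory.Graph_Theory" "HOL-Library.Extended_Real"
begin

text \<open>
  A finite simple undirected graph is a term satisfying \<^const>\<open>graph\<close>: a finite symmetric digraph
  without loops and parallel arcs. An undirected edge \<open>{u, v}\<close> is thus represented by a pair of
  opposite arcs.
\<close>

definition edges :: "('a,'b) pre_digraph \<Rightarrow> 'a set set" where
  "edges G = (\<lambda>a. {tail G a, head G a}) ` arcs G"

definition del_verts :: "('a,'b) pre_digraph \<Rightarrow> 'a set \<Rightarrow> ('a,'b) pre_digraph" where
  "del_verts G X = G \<restriction> (verts G - X)"

text \<open>Both arcs representing the edge \<open>e\<close> are removed.\<close>

definition del_edge :: "('a,'b) pre_digraph \<Rightarrow> 'a set \<Rightarrow> ('a,'b) pre_digraph" where
  "del_edge G e = G\<lparr>arcs := {a \<in> arcs G. {tail G a, head G a} \<noteq> e}\<rparr>"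

definition k_connected :: "nat \<Rightarrow> ('a,'b) pre_digraph \<Rightarrow> bool" where
  "k_connected k G \<longleftrightarrow> k < card (verts G) \<and>
     (\<forall>X \<subseteq> verts G. card X < k \<longrightarrow> Digraph_Component.connected (del_verts G X))"

definition num_isolated :: "('a,'b) pre_digraph \<Rightarrow> nat" where
  "num_isolated G = card {v \<in> verts G. in_arcs G v = {} \<and> out_arcs G v = {}}"

definition complete_graph :: "('a,'b) pre_digraph \<Rightarrow> bool" where
  "complete_graph G \<longleftrightarrow> complete_digraph (card (verts G)) G"

definition isolated_toughness :: "('a,'b) pre_digraph \<Rightarrow> ereal" where
  "isolated_toughness G =
     (if complete_graph G then \<infinity>
      else Min {ereal (real (card X) / real (num_isolated (del_verts G X))) | X.
                  X \<subseteq> verts G \<and> num_isolated (del_verts G X) \<ge> 2})"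

definition path_graph :: "('a,'b) pre_digraph \<Rightarrow> bool" where
  "path_graph P \<longleftrightarrow> graph P \<and>
     (\<exists>p. p \<noteq> [] \<and> distinct p \<and> verts P = set p \<and>
          edges P = {{p ! i, p ! Suc i} | i. Suc i < length p})"

text \<open>
  In a symmetric digraph the strongly connected components are the connected components of the
  underlying undirected graph.
\<close>

definition path_factor :: "('a,'b) pre_digraph \<Rightarrow> ('a,'b) pre_digraph \<Rightarrow> bool" where
  "path_factor F G \<longleftrightarrow> graph F \<and> spanning F G \<and>
     (\<forall>C \<in> pre_digraph.sccs F. path_graph C \<and> 2 \<le> card (verts C))"

definition P_ge_factor :: "nat \<Rightarrow> ('a,'b) pre_digraph \<Rightarrow> ('a,'b) pre_digraph \<Rightarrow> bool" where
  "P_ge_factor k F G \<longleftrightarrow> path_factor F G \<and> (\<forall>C \<in> pre_digraph.sccs F. k \<le> card (verts C))"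

definition factor_avoidable :: "nat \<Rightarrow> ('a,'b) pre_digraph \<Rightarrow> bool" where
  "factor_avoidable k G \<longleftrightarrow> (\<forall>e \<in> edges G. \<exists>F. P_ge_factor k F G \<and> e \<notin> edges F)"

definition factor_critical_avoidable :: "nat \<Rightarrow> nat \<Rightarrow> ('a,'b) pre_digraph \<Rightarrow> bool" where
  "factor_critical_avoidable k n G \<longleftrightarrow>
     (\<forall>W \<subseteq> verts G. card W = n \<longrightarrow> factor_avoidable k (del_verts G W))"

end

theory Submission
  imports Defs
begin

text \<open>
  By Kaneko's theorem, a graph has a path factor with all paths of order at least three if for every
  vertex set \<open>X\<close> at most \<open>2 |X|\<close> components of \<open>G - X\<close> are suns, a sun being a single vertex or a corona
  of a factor-critical graph. It is proved by induction. If the bound is attained, Hall's theorem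
  gives every vertex of \<open>X\<close> two suns, and a vertex with two suns attached can be covered by paths;
  the other components satisfy the bound themselves. If the bound is nowhere attained by a nonempty
  set and there is no path factor, then a vertex occurring in a set with \<open>2 |X| - 1\<close> suns carries a
  pendant vertex, this property spreads along edges, and so the whole graph is a sun.

  Now let \<open>W\<close>, \<open>e = {a, b}\<close> be given, and suppose that \<open>G - W - e - X\<close> has more than \<open>2 |X|\<close> suns. By
  connectivity \<open>|X| \<ge> r + 2\<close>. Every corona splits into two equally large halves, one of which becomes
  a set of isolated vertices when the other is deleted, and the deleted half may be chosen so as to
  contain a prescribed vertex; so \<open>a\<close> or \<open>b\<close> can be deleted whenever it lies in a corona. This yields
  \<open>i \<ge> 2 |X|\<close> isolated vertices at the cost of deleting at most \<open>n + |X| + i\<close> vertices, which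
  contradicts the bound on the isolated toughness.
\<close>

section \<open>Hall's theorem with demands\<close>

text \<open>Induction on the number of indices. A proper nonempty \<open>J\<close> whose union has
  exactly \<open>card J\<close> elements is matched into that union, and outside of it the remaining
  indices inherit the condition. If there is no such \<open>J\<close>, every proper nonempty subset
  has an element to spare, so one index may take any value, which is then removed.\<close>

lemma hall:
  assumes "finite I" "\<And>i. i \<in> I \<Longrightarrow> finite (A i)"
    and "\<And>J. J \<subseteq> I \<Longrightarrow> card J \<le> card (\<Union>(A ` J))"
  shows "\<exists>f. inj_on f I \<and> (\<forall>i\<in>I. f i \<in> A i)"
  using assms
proof (induction "card I" arbitrary: I A rule: less_induct)
  case less
  note fin = less.prems(1) and finA = less.prems(2) and hc = less.prems(3)
  have finU: "finite (\<Union>(A ` J))" if "J \<subseteq> I" for J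
    using that fin finA by (auto intro: finite_subset)
  show ?case
  proof (cases "I = {}")
    case True then show ?thesis by simp
  next
    case False
    show ?thesis
    proof (cases "\<exists>J. J \<subset> I \<and> J \<noteq> {} \<and> card (\<Union>(A ` J)) = card J")
      case True
      then obtain J where J: "J \<subset> I" "J \<noteq> {}" "card (\<Union>(A ` J)) = card J" by blast
      have finJ: "finite J" using J fin finite_subset by blast
      have "card J < card I" using J fin by (simp add: psubset_card_mono)
      then have "\<exists>f. inj_on f J \<and> (\<forall>i\<in>J. f i \<in> A i)"
      proof (rule less.hyps)
        show "finite J" by fact
        show "finite (A i)" if "i \<in> J" for i using that J finA by blast
        show "card K \<le> card (\<Union>(A ` K))" if "K \<subseteq> J" for K using that J hc by blast
      qed
      then obtain f where f: "inj_on f J" "\<forall>i\<in>J. f i \<in> A i" by blast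
      let ?U = "\<Union>(A ` J)"
      have "card K \<le> card (\<Union>i\<in>K. A i - ?U)" if K: "K \<subseteq> I - J" for K
      proof -
        have finK: "finite K" using K fin finite_subset by blast
        have "card K + card J = card (K \<union> J)"
          using K finK finJ by (subst card_Un_disjoint) auto
        also have "\<dots> \<le> card (\<Union>(A ` (K \<union> J)))" using hc[of "K \<union> J"] K J by blast
        also have "\<Union>(A ` (K \<union> J)) = (\<Union>i\<in>K. A i - ?U) \<union> ?U" by auto
        also have "card \<dots> = card (\<Union>i\<in>K. A i - ?U) + card ?U"
        proof (rule card_Un_disjoint)
          show "finite (\<Union>i\<in>K. A i - ?U)" using finK K finA by auto
          show "finite ?U" using finU J by blast
        qed auto
        finally show ?thesis using J by simp
      qed
      moreover have "card (I - J) < card I"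
        using J fin by (intro psubset_card_mono) auto
      ultimately have "\<exists>g. inj_on g (I - J) \<and> (\<forall>i\<in>I - J. g i \<in> A i - ?U)"
        by (intro less.hyps) (use fin finA in auto)
      then obtain g where g: "inj_on g (I - J)" "\<forall>i\<in>I - J. g i \<in> A i - ?U" by blast
      let ?h = "\<lambda>i. if i \<in> J then f i else g i"
      have "inj_on ?h I"
      proof (rule inj_onI)
        fix x y assume xy: "x \<in> I" "y \<in> I" "?h x = ?h y"
        have *: "f a \<noteq> g b" if "a \<in> J" "b \<in> I" "b \<notin> J" for a b
          using f(2) g(2) that by (metis DiffD2 DiffI UN_I)
        show "x = y"
          using xy f(1) g(1) *[of x y] *[of y x] by (auto split: if_splits simp: inj_on_def)
      qed
      moreover have "\<forall>i\<in>I. ?h i \<in> A i" using f g by auto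
      ultimately show ?thesis by blast
    next
      case nt: False
      obtain i where i: "i \<in> I" using False by blast
      have "card {i} \<le> card (\<Union>(A ` {i}))" using hc[of "{i}"] i by blast
      then have "A i \<noteq> {}" by auto
      then obtain a where a: "a \<in> A i" by blast
      have "card K \<le> card (\<Union>j\<in>K. A j - {a})" if K: "K \<subseteq> I - {i}" for K
      proof (cases "K = {}")
        case False
        have "card K \<noteq> card (\<Union>(A ` K))" using nt K False i by (metis Diff_iff insertI1 psubsetI subset_Diff_insert subset_iff)
        then have "card K < card (\<Union>(A ` K))" using hc[of K] K by fastforce
        moreover have "(\<Union>j\<in>K. A j - {a}) = \<Union>(A ` K) - {a}" by auto
        moreover have "finite (\<Union>(A ` K))" using finU K by blast
        ultimately show ?thesis by (auto simp: card_Diff_singleton_if)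
      qed simp
      moreover have "card (I - {i}) < card I" using i fin by (intro psubset_card_mono) auto
      ultimately have "\<exists>g. inj_on g (I - {i}) \<and> (\<forall>j\<in>I - {i}. g j \<in> A j - {a})"
        by (intro less.hyps) (use fin finA in auto)
      then obtain g where g: "inj_on g (I - {i})" "\<forall>j\<in>I - {i}. g j \<in> A j - {a}" by blast
      have "inj_on (g(i := a)) I" using g by (auto simp: inj_on_def)
      moreover have "\<forall>j\<in>I. (g(i := a)) j \<in> A j" using g a by auto
      ultimately show ?thesis by blast
    qed
  qed
qed

text \<open>Each \<open>x\<close> is replaced by \<open>d x\<close> copies of itself, the pairs
  \<open>(x, k)\<close> with \<open>k < d x\<close>, and \<open>hall\<close> is applied to the
  copies.\<close>

lemma hall_demand:
  fixes d :: "'a \<Rightarrow> nat"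
  assumes "finite X" "\<And>x. x \<in> X \<Longrightarrow> finite (N x)"
    and "\<And>Z. Z \<subseteq> X \<Longrightarrow> sum d Z \<le> card (\<Union>(N ` Z))"
  obtains M where "\<And>x. x \<in> X \<Longrightarrow> M x \<subseteq> N x" "\<And>x. x \<in> X \<Longrightarrow> card (M x) = d x"
    "\<And>x y. x \<in> X \<Longrightarrow> y \<in> X \<Longrightarrow> x \<noteq> y \<Longrightarrow> M x \<inter> M y = {}"
proof -
  let ?I = "Sigma X (\<lambda>x. {..<d x})"
  have "\<exists>f. inj_on f ?I \<and> (\<forall>i\<in>?I. f i \<in> N (fst i))"
  proof (rule hall)
    show "finite ?I" using assms(1) by auto
    show "finite (N (fst i))" if "i \<in> ?I" for i using that assms(2) by auto
    show "card J \<le> card (\<Union>i\<in>J. N (fst i))" if J: "J \<subseteq> ?I" for J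
    proof -
      have Z: "fst ` J \<subseteq> X" using J by auto
      then have fin: "finite (fst ` J)" using assms(1) finite_subset by blast
      have "J \<subseteq> Sigma (fst ` J) (\<lambda>x. {..<d x})" using J by force
      then have "card J \<le> card (Sigma (fst ` J) (\<lambda>x. {..<d x}))" using fin by (intro card_mono) auto
      also have "\<dots> = sum d (fst ` J)" using fin by (simp add: card_SigmaI)
      also have "\<dots> \<le> card (\<Union>(N ` fst ` J))" using assms(3) Z by blast
      finally show ?thesis by (simp add: image_comp)
    qed
  qed
  then obtain f where f: "inj_on f ?I" "\<And>i. i \<in> ?I \<Longrightarrow> f i \<in> N (fst i)" by blast
  define M where "M x = f ` ({x} \<times> {..<d x})" for x
  show ?thesis
  proof
    show "M x \<subseteq> N x" if "x \<in> X" for x using f(2) that by (fastforce simp: M_def)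
    show "card (M x) = d x" if "x \<in> X" for x
    proof -
      have "inj_on f ({x} \<times> {..<d x})" using f(1) that by (auto intro: inj_on_subset)
      then show ?thesis by (simp add: M_def card_image card_cartesian_product)
    qed
    show "M x \<inter> M y = {}" if "x \<in> X" "y \<in> X" "x \<noteq> y" for x y
      using f(1) that unfolding M_def inj_on_def by fastforce
  qed
qed

section \<open>Components\<close>

definition linked :: "('a \<times> 'a) set \<Rightarrow> 'a set \<Rightarrow> 'a set \<Rightarrow> bool" where
  "linked E A B \<longleftrightarrow> (\<exists>a\<in>A. \<exists>b\<in>B. (a, b) \<in> E)"

text \<open>Connectedness is phrased by cuts instead of walks. The relation \<open>E\<close> stays
  fixed while only vertex sets vary, so no induced subgraphs have to be formed. The empty set does
  not count as connected.\<close>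

definition cut_connected :: "('a \<times> 'a) set \<Rightarrow> 'a set \<Rightarrow> bool" where
  "cut_connected E S \<longleftrightarrow> S \<noteq> {} \<and> (\<forall>T. T \<subset> S \<longrightarrow> T \<noteq> {} \<longrightarrow> linked E T (S - T))"

definition comps :: "('a \<times> 'a) set \<Rightarrow> 'a set \<Rightarrow> 'a set set" where
  "comps E A = {S. S \<subseteq> A \<and> cut_connected E S \<and> \<not> linked E S (A - S)}"

lemma linked_mono: "linked E A B \<Longrightarrow> A \<subseteq> A' \<Longrightarrow> B \<subseteq> B' \<Longrightarrow> linked E A' B'"
  by (auto simp: linked_def)

lemma linked_sym: "sym E \<Longrightarrow> linked E A B \<longleftrightarrow> linked E B A"
  by (auto simp: linked_def sym_def)

lemma comps_finite: "finite A \<Longrightarrow> finite (comps E A)"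
  by (rule finite_subset[of _ "Pow A"]) (auto simp: comps_def)

lemma comps_subset: "S \<in> comps E A \<Longrightarrow> S \<subseteq> A"
  and comps_nonempty: "S \<in> comps E A \<Longrightarrow> S \<noteq> {}"
  by (auto simp: comps_def cut_connected_def)

text \<open>If \<open>S\<close> were not contained in \<open>S'\<close>, connectedness of
  \<open>S\<close> would give an edge from the intersection to the rest of \<open>S\<close>, and
  this edge would leave \<open>S'\<close>.\<close>

lemma comps_eqI:
  assumes "S \<in> comps E A" "S' \<in> comps E A" "S \<inter> S' \<noteq> {}"
  shows "S = S'"
proof -
  have "S \<subseteq> S'" if "S \<in> comps E A" "S' \<in> comps E A" "S \<inter> S' \<noteq> {}" for S S'
  proof (rule ccontr)
    assume "\<not> S \<subseteq> S'"
    then have "linked E (S \<inter> S') (S - S \<inter> S')"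
      using that by (auto simp: comps_def cut_connected_def)
    then have "linked E S' (A - S')" using comps_subset[OF that(1)] by (elim linked_mono) auto
    then show False using that by (auto simp: comps_def)
  qed
  then show ?thesis using assms by (simp add: Int_commute subset_antisym)
qed

text \<open>A smallest set that contains \<open>v\<close> and has no edge leaving it is the
  component: an edgeless cut would make the side of \<open>v\<close> a smaller such set. Symmetry is
  used when \<open>v\<close> lies on the far side of the cut.\<close>

lemma comps_cover:
  assumes "sym E" "finite A" "v \<in> A"
  obtains S where "S \<in> comps E A" "v \<in> S"
proof -
  define P where "P T \<longleftrightarrow> T \<subseteq> A \<and> v \<in> T \<and> \<not> linked E T (A - T)" for T
  have "P A" using assms by (auto simp: P_def linked_def)
  then obtain S where S: "P S" and min: "\<And>T. P T \<Longrightarrow> card S \<le> card T"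
    using ex_has_least_nat[of P A card] by blast
  have finS: "finite S" using S assms finite_subset by (auto simp: P_def)
  have "cut_connected E S"
    unfolding cut_connected_def
  proof (intro conjI allI impI)
    show "S \<noteq> {}" using S by (auto simp: P_def)
    fix T assume T: "T \<subset> S" "T \<noteq> {}"
    show "linked E T (S - T)"
    proof (rule ccontr)
      assume n: "\<not> linked E T (S - T)"
      have nl: "\<not> linked E S (A - S)" using S by (simp add: P_def)
      have n': "\<not> linked E (S - T) T" using n linked_sym[OF assms(1)] by blast
      have 1: "P T" if "v \<in> T" using that T S n nl unfolding P_def linked_def by blast
      have 2: "P (S - T)" if "v \<notin> T" using that T S n' nl unfolding P_def linked_def by blast
      have "card T < card S" "card (S - T) < card S"
        using T finS by (auto intro: psubset_card_mono)
      then show False using 1 2 min by (meson leD)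
    qed
  qed
  then have "S \<in> comps E A" using S by (auto simp: comps_def P_def)
  then show ?thesis using that S by (auto simp: P_def)
qed

lemma Union_comps: "sym E \<Longrightarrow> finite A \<Longrightarrow> \<Union>(comps E A) = A"
  using comps_cover[of E A] comps_subset[of _ E A] by (intro equalityI subsetI) (metis Union_iff subsetD)+

lemma comps_unlinked_extend:
  assumes "S \<in> comps E A" "A \<subseteq> B" "\<not> linked E S (B - A)"
  shows "S \<in> comps E B"
  using assms unfolding comps_def linked_def by blast

lemma comps_connected: "cut_connected E A \<Longrightarrow> comps E A = {A}"
proof -
  assume c: "cut_connected E A"
  have "A \<in> comps E A" using c by (auto simp: comps_def linked_def)
  moreover have "S = A" if "S \<in> comps E A" for S
    using comps_eqI[OF that \<open>A \<in> comps E A\<close>] comps_subset[OF that] comps_nonempty[OF that] by blast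
  ultimately show ?thesis by blast
qed

lemma comps_delete_within:
  assumes "K \<in> comps E A" "Y \<subseteq> K"
  shows "comps E (K - Y) \<union> (comps E A - {K}) \<subseteq> comps E (A - Y)"
proof
  fix S assume "S \<in> comps E (K - Y) \<union> (comps E A - {K})"
  then show "S \<in> comps E (A - Y)"
  proof
    assume S: "S \<in> comps E (K - Y)"
    then have "\<not> linked E S (A - Y - (K - Y))"
      using assms comps_subset[OF S] unfolding comps_def linked_def by blast
    then show ?thesis using S comps_unlinked_extend[of S E "K - Y" "A - Y"] comps_subset[OF assms(1)]
      by blast
  next
    assume S: "S \<in> comps E A - {K}"
    then have "S \<inter> K = {}" using comps_eqI assms by blast
    then show ?thesis using S assms unfolding comps_def linked_def by blast
  qed
qed

lemma comps_singleton:
  assumes "l \<in> A" "\<And>y. y \<in> A \<Longrightarrow> (l, y) \<in> E \<Longrightarrow> y = l"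
  shows "{l} \<in> comps E A"
  using assms by (auto simp: comps_def cut_connected_def linked_def)

lemma comps_delete_edge:
  assumes "S \<in> comps (E - {(a, b), (b, a)}) A" "a \<notin> S" "b \<notin> S"
  shows "S \<in> comps E A"
proof -
  have *: "linked (E - {(a, b), (b, a)}) T U \<longleftrightarrow> linked E T U" if "T \<subseteq> S" for T U
    using that assms(2,3) by (auto simp: linked_def)
  show ?thesis using assms(1) * by (auto simp: comps_def cut_connected_def psubset_eq)
qed

section \<open>Path partitions and suns\<close>

definition is_path :: "('a \<times> 'a) set \<Rightarrow> 'a list \<Rightarrow> bool" where
  "is_path E p \<longleftrightarrow> distinct p \<and> successively (\<lambda>x y. (x, y) \<in> E) p"

text \<open>Lists replace subgraphs here; \<open>path_partition_imp_P_ge_factor\<close> translates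
  back at the end.\<close>

definition path_partition :: "('a \<times> 'a) set \<Rightarrow> 'a set \<Rightarrow> 'a list set \<Rightarrow> bool" where
  "path_partition E A P \<longleftrightarrow> (\<forall>p\<in>P. is_path E p \<and> 3 \<le> length p) \<and>
     (\<forall>p\<in>P. \<forall>q\<in>P. p \<noteq> q \<longrightarrow> set p \<inter> set q = {}) \<and> \<Union>(set ` P) = A"

definition p3_factorable :: "('a \<times> 'a) set \<Rightarrow> 'a set \<Rightarrow> bool" where
  "p3_factorable E A \<longleftrightarrow> (\<exists>P. path_partition E A P)"

text \<open>
  The non-singleton suns are the coronas \<open>R \<union> l ` R\<close>, where \<open>l r\<close> is the pendant vertex at \<open>r\<close>.
  Instead of asking that \<open>R\<close> be factor-critical, we only record the path partitions which that
  property provides. The complete graph on two vertices is the case \<open>card R = 1\<close>.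
\<close>

definition corona :: "('a \<times> 'a) set \<Rightarrow> 'a set \<Rightarrow> 'a set \<Rightarrow> ('a \<Rightarrow> 'a) \<Rightarrow> bool" where
  "corona E S R l \<longleftrightarrow> finite R \<and> R \<noteq> {} \<and> card R \<noteq> 2 \<and> inj_on l R \<and> R \<inter> l ` R = {} \<and>
     S = R \<union> l ` R \<and> (\<forall>r\<in>R. \<forall>y\<in>S. (l r, y) \<in> E \<longleftrightarrow> y = r) \<and>
     (\<forall>r\<in>R. p3_factorable E (S - {r, l r}))"

definition sun :: "('a \<times> 'a) set \<Rightarrow> 'a set \<Rightarrow> bool" where
  "sun E S \<longleftrightarrow> (\<exists>v. S = {v}) \<or> (\<exists>R l. corona E S R l)"

definition suns :: "('a \<times> 'a) set \<Rightarrow> 'a set \<Rightarrow> 'a set set" where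
  "suns E A = {S \<in> comps E A. sun E S}"

lemma p3_factorable_empty: "p3_factorable E {}"
  by (auto simp: p3_factorable_def path_partition_def)

lemma p3_factorable_path: "is_path E p \<Longrightarrow> 3 \<le> length p \<Longrightarrow> p3_factorable E (set p)"
  unfolding p3_factorable_def path_partition_def by (rule exI[of _ "{p}"]) auto

lemma p3_factorable_Un:
  assumes "p3_factorable E A" "p3_factorable E B" "A \<inter> B = {}"
  shows "p3_factorable E (A \<union> B)"
proof -
  obtain P Q where P: "path_partition E A P" and Q: "path_partition E B Q"
    using assms by (auto simp: p3_factorable_def)
  have "path_partition E (A \<union> B) (P \<union> Q)"
    unfolding path_partition_def
  proof (intro conjI)
    have "set p \<inter> set q = {}" if "p \<in> P" "q \<in> Q" for p q
      using that P Q assms(3) unfolding path_partition_def by blast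
    then show "\<forall>p\<in>P \<union> Q. \<forall>q\<in>P \<union> Q. p \<noteq> q \<longrightarrow> set p \<inter> set q = {}"
      using P Q unfolding path_partition_def by blast
  qed (use P Q in \<open>auto simp: path_partition_def\<close>)
  then show ?thesis by (auto simp: p3_factorable_def)
qed

lemma p3_factorable_UN:
  assumes "finite I" "\<And>i. i \<in> I \<Longrightarrow> p3_factorable E (B i)"
    and "\<And>i j. i \<in> I \<Longrightarrow> j \<in> I \<Longrightarrow> i \<noteq> j \<Longrightarrow> B i \<inter> B j = {}"
  shows "p3_factorable E (\<Union>(B ` I))"
  using assms
proof (induction I rule: finite_induct)
  case empty
  then show ?case by (simp add: p3_factorable_empty)
next
  case (insert x F)
  have "B x \<inter> \<Union>(B ` F) = {}"
    using insert.prems(2)[of x] insert.hyps by blast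
  then show ?case using insert p3_factorable_Un[of E "B x" "\<Union>(B ` F)"] by simp
qed

lemma p3_factorable_mono:
  assumes "p3_factorable E A" "E \<subseteq> E'"
  shows "p3_factorable E' A"
proof -
  have "is_path E' p" if "is_path E p" for p
  proof -
    have "successively (\<lambda>x y. (x, y) \<in> E') p"
      by (rule successively_mono[of "\<lambda>x y. (x, y) \<in> E"]) (use that assms(2) in \<open>auto simp: is_path_def\<close>)
    then show ?thesis using that by (simp add: is_path_def)
  qed
  moreover obtain P where "path_partition E A P" using assms(1) by (auto simp: p3_factorable_def)
  ultimately have "path_partition E' A P" by (simp add: path_partition_def)
  then show ?thesis by (auto simp: p3_factorable_def)
qed

text \<open>In a corona, \<open>v\<close> and its partner (its pendant vertex, or the vertex it
  hangs on) form an arm of two vertices starting at \<open>v\<close>, and the definition of a corona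
  supplies a partition of the rest. A one-vertex sun only gives an arm of one vertex.\<close>

lemma sun_arm:
  assumes "sym E" "sun E S" "v \<in> S"
  obtains p where "is_path E p" "p \<noteq> []" "hd p = v" "set p \<subseteq> S" "p3_factorable E (S - set p)"
    "card S \<noteq> 1 \<Longrightarrow> 2 \<le> length p"
proof (cases "\<exists>v. S = {v}")
  case True
  then show ?thesis using that[of "[v]"] assms by (auto simp: is_path_def p3_factorable_empty)
next
  case False
  then obtain R l where c: "corona E S R l" using assms by (auto simp: sun_def)
  from c assms(3) obtain r where r: "r \<in> R" "v = r \<or> v = l r" by (auto simp: corona_def)
  have e: "(l r, r) \<in> E" "(r, l r) \<in> E" "l r \<noteq> r" "r \<in> S" "l r \<in> S"
  proof -
    have S: "S = R \<union> l ` R" "R \<inter> l ` R = {}" and E: "\<forall>r\<in>R. \<forall>y\<in>S. (l r, y) \<in> E \<longleftrightarrow> y = r"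
      using c by (simp_all add: corona_def)
    show rS: "r \<in> S" and "l r \<in> S" using S r(1) by auto
    show "l r \<noteq> r" using S(2) r(1) by force
    show "(l r, r) \<in> E" using E r(1) rS by simp
    then show "(r, l r) \<in> E" using assms(1) by (rule symD[rotated])
  qed
  have f: "p3_factorable E (S - {r, l r})" using c r by (auto simp: corona_def)
  from r(2) show ?thesis
  proof
    assume "v = r"
    then show ?thesis using that[of "[r, l r]"] e f by (auto simp: is_path_def)
  next
    assume "v = l r"
    then show ?thesis using that[of "[l r, r]"] e f by (auto simp: is_path_def insert_commute)
  qed
qed

text \<open>The arm from \<open>sun_arm\<close> that starts at a neighbour of \<open>last q\<close>
  is appended to \<open>q\<close>.\<close>

lemma attach_sun:
  assumes "sym E" "is_path E q" "q \<noteq> []" "sun E S" "linked E {last q} S" "set q \<inter> S = {}"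
  obtains p where "is_path E p" "p \<noteq> []" "hd p = hd q" "set q \<subseteq> set p" "set p \<subseteq> set q \<union> S"
    "p3_factorable E (S - set p)" "length q + 1 \<le> length p"
    "card S \<noteq> 1 \<longrightarrow> length q + 2 \<le> length p"
proof -
  obtain v where v: "v \<in> S" "(last q, v) \<in> E" using assms(5) by (auto simp: linked_def)
  obtain p where p: "is_path E p" "p \<noteq> []" "hd p = v" "set p \<subseteq> S" "p3_factorable E (S - set p)"
    "card S \<noteq> 1 \<Longrightarrow> 2 \<le> length p"
    using sun_arm[OF assms(1,4) v(1)] by blast
  have "S - set (q @ p) = S - set p" using assms(6) by auto
  moreover have "is_path E (q @ p)"
    using assms p v by (auto simp: is_path_def successively_append_iff)
  moreover have "1 \<le> length p" using p(2) by (cases p) auto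
  ultimately show ?thesis using that[of "q @ p"] p assms(3) by auto
qed

lemma is_path_rev:
  assumes "sym E" "is_path E p"
  shows "is_path E (rev p)"
proof -
  have "successively (\<lambda>x y. (y, x) \<in> E) p"
    by (rule successively_mono[of "\<lambda>x y. (x, y) \<in> E"])
      (use assms in \<open>simp_all add: is_path_def symD\<close>)
  then show ?thesis using assms(2) by (simp add: is_path_def)
qed

text \<open>Both ends of \<open>q\<close> are prolonged by an arm, the second time after reversing
  the path. Each arm and \<open>q\<close> itself have at least one vertex, so the result has order
  at least three. The case \<open>q = [x]\<close> is that of one vertex serving two suns.\<close>

lemma p3_factorable_path_two_suns:
  assumes "sym E" "is_path E q" "q \<noteq> []" "sun E S" "sun E T" "linked E {hd q} S" "linked E {last q} T"
    and "set q \<inter> S = {}" "set q \<inter> T = {}" "S \<inter> T = {}"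
  shows "p3_factorable E (set q \<union> S \<union> T)"
proof -
  obtain p where p: "is_path E p" "p \<noteq> []" "hd p = hd q" "set q \<subseteq> set p" "set p \<subseteq> set q \<union> T"
    "p3_factorable E (T - set p)" "length q + 1 \<le> length p"
    "card T \<noteq> 1 \<longrightarrow> length q + 2 \<le> length p"
    by (rule attach_sun[OF assms(1,2,3,5,7,9)])
  have d: "set (rev p) \<inter> S = {}" using p assms by auto
  have lk: "linked E {last (rev p)} S" using assms p by (simp add: last_rev)
  have "rev p \<noteq> []" using p(2) by simp
  then obtain p' where p': "is_path E p'" "p' \<noteq> []" "hd p' = hd (rev p)" "set (rev p) \<subseteq> set p'"
    "set p' \<subseteq> set (rev p) \<union> S" "p3_factorable E (S - set p')" "length (rev p) + 1 \<le> length p'"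
    "card S \<noteq> 1 \<longrightarrow> length (rev p) + 2 \<le> length p'"
    by (rule attach_sun[OF assms(1) is_path_rev[OF assms(1) p(1)] _ assms(4) lk d])
  have "length q \<ge> 1" using assms(3) by (cases q) auto
  then have "p3_factorable E (set p')" using p' p(7) by (intro p3_factorable_path) auto
  then have "p3_factorable E (set p' \<union> (S - set p') \<union> (T - set p))"
    using p' p assms by (intro p3_factorable_Un) auto
  moreover have "set p' \<union> (S - set p') \<union> (T - set p) = set q \<union> S \<union> T" using p p' assms by auto
  ultimately show ?thesis by simp
qed

text \<open>A corona contributes an arm of two vertices, so together with \<open>x\<close> one sun
  already suffices.\<close>

lemma p3_factorable_path_big_sun:
  assumes "sym E" "sun E S" "card S \<noteq> 1" "linked E {x} S" "x \<notin> S"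
  shows "p3_factorable E (insert x S)"
proof -
  have "is_path E [x]" "[x] \<noteq> []" "linked E {last [x]} S" "set [x] \<inter> S = {}"
    using assms by (simp_all add: is_path_def)
  then obtain p where p: "is_path E p" "p \<noteq> []" "hd p = hd [x]" "set [x] \<subseteq> set p"
    "set p \<subseteq> set [x] \<union> S" "p3_factorable E (S - set p)" "length [x] + 1 \<le> length p"
    "card S \<noteq> 1 \<longrightarrow> length [x] + 2 \<le> length p"
    using attach_sun[OF assms(1) _ _ assms(2)] by metis
  have "p3_factorable E (set p \<union> (S - set p))"
    using p assms(3) by (intro p3_factorable_Un p3_factorable_path) auto
  moreover have "set p \<union> (S - set p) = insert x S" using p by auto
  ultimately show ?thesis by simp
qed

section \<open>A sufficient condition for path partitions\<close>

text \<open>Kaneko's condition. For finite \<open>V\<close> the instance \<open>X = {}\<close> says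
  that no component of \<open>V\<close> itself is a sun.\<close>

definition sun_bounded :: "('a \<times> 'a) set \<Rightarrow> 'a set \<Rightarrow> bool" where
  "sun_bounded E V \<longleftrightarrow> (\<forall>X\<subseteq>V. card (suns E (V - X)) \<le> 2 * card X)"

lemma suns_finite: "finite A \<Longrightarrow> finite (suns E A)"
  by (simp add: suns_def comps_finite)

lemma suns_comps: "suns E A \<subseteq> comps E A"
  by (auto simp: suns_def)

lemma suns_unlinked_extend:
  assumes "S \<in> suns E A" "A \<subseteq> B" "\<not> linked E S (B - A)"
  shows "S \<in> suns E B"
  using assms comps_unlinked_extend[of S E A B] by (simp add: suns_def)

lemma suns_singleton:
  assumes "l \<in> A" "\<And>y. y \<in> A \<Longrightarrow> (l, y) \<in> E \<Longrightarrow> y = l"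
  shows "{l} \<in> suns E A"
  using comps_singleton[of l A E] assms by (auto simp: suns_def sun_def)

section \<open>Distributing suns among the deleted vertices\<close>

lemma Union_comps_disjoint:
  assumes "\<A> \<subseteq> comps E A" "\<B> \<subseteq> comps E A" "\<A> \<inter> \<B> = {}"
  shows "\<Union>\<A> \<inter> \<Union>\<B> = {}"
proof (rule ccontr)
  assume "\<Union>\<A> \<inter> \<Union>\<B> \<noteq> {}"
  then obtain S T where ST: "S \<in> \<A>" "T \<in> \<B>" "S \<inter> T \<noteq> {}" by auto
  then have "S = T" using comps_eqI assms(1,2) by (meson subsetD)
  then show False using ST assms(3) by blast
qed

text \<open>The demand \<open>d x\<close> is two in general. Vertices treated separately have demand
  one or are left out of \<open>X\<close>, and \<open>Q\<close> omits the suns reserved for the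
  latter.\<close>

definition sun_assigned ::
  "('a \<times> 'a) set \<Rightarrow> 'a set \<Rightarrow> 'a set set \<Rightarrow> ('a \<Rightarrow> nat) \<Rightarrow> ('a \<Rightarrow> 'a set set) \<Rightarrow> bool" where
  "sun_assigned E X Q d M \<longleftrightarrow>
     (\<forall>x\<in>X. M x \<subseteq> Q \<and> card (M x) = d x \<and> (\<forall>S\<in>M x. linked E {x} S)) \<and>
     (\<forall>x\<in>X. \<forall>y\<in>X. x \<noteq> y \<longrightarrow> M x \<inter> M y = {}) \<and> \<Union>(M ` X) = Q"

lemma sun_assignedD:
  assumes "sun_assigned E X Q d M"
  shows "\<And>x. x \<in> X \<Longrightarrow> M x \<subseteq> Q" "\<And>x. x \<in> X \<Longrightarrow> card (M x) = d x"
    "\<And>x S. x \<in> X \<Longrightarrow> S \<in> M x \<Longrightarrow> linked E {x} S"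
    "\<And>x y. x \<in> X \<Longrightarrow> y \<in> X \<Longrightarrow> x \<noteq> y \<Longrightarrow> M x \<inter> M y = {}" "\<Union>(M ` X) = Q"
  using assms by (simp_all add: sun_assigned_def)

text \<open>A sun of \<open>V - X\<close> with no edge to \<open>Z\<close> remains a sun when
  \<open>Z\<close> is put back, so all but at most \<open>card (suns E (V - (X - Z)))\<close> suns
  are adjacent to \<open>Z\<close>. The last premise therefore gives Hall's condition. As the
  demands add up to \<open>card Q\<close>, all of \<open>Q\<close> is used.\<close>

lemma sun_assignment:
  fixes d :: "'a \<Rightarrow> nat"
  assumes "sym E" "finite V" "X \<subseteq> V" "X0 \<subseteq> X" and Q: "Q \<subseteq> suns E (V - X)" "sum d X0 = card Q"
    and d: "\<And>Z. Z \<subseteq> X0 \<Longrightarrow> Z \<noteq> {} \<Longrightarrow>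
      sum d Z + card (suns E (V - (X - Z))) + card (suns E (V - X) - Q) \<le> card (suns E (V - X))"
  shows "\<exists>M. sun_assigned E X0 Q d M"
proof -
  define N where "N x = {S \<in> Q. linked E {x} S}" for x
  have finX: "finite X0" using assms finite_subset by metis
  have fins: "finite (suns E (V - Y))" for Y using assms(2) by (simp add: suns_finite)
  have finQ: "finite Q" using Q(1) fins finite_subset by blast
  have "sum d Z \<le> card (\<Union>(N ` Z))" if Z: "Z \<subseteq> X0" for Z
  proof (cases "Z = {}")
    case False
    have "suns E (V - X) \<subseteq> \<Union>(N ` Z) \<union> suns E (V - (X - Z)) \<union> (suns E (V - X) - Q)"
    proof
      fix S assume S: "S \<in> suns E (V - X)"
      show "S \<in> \<Union>(N ` Z) \<union> suns E (V - (X - Z)) \<union> (suns E (V - X) - Q)"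
      proof (cases "linked E S Z")
        case True
        then have "\<exists>z\<in>Z. linked E {z} S"
          using linked_sym[OF assms(1), of S Z] by (auto simp: linked_def)
        then show ?thesis using S by (auto simp: N_def)
      next
        case False
        have "\<not> linked E S (V - (X - Z) - (V - X))"
          using False by (auto simp: linked_def)
        then have "S \<in> suns E (V - (X - Z))"
          by (intro suns_unlinked_extend[OF S]) auto
        then show ?thesis by blast
      qed
    qed
    moreover have finN: "finite (\<Union>(N ` Z))" by (rule finite_subset[OF _ finQ]) (auto simp: N_def)
    ultimately have "card (suns E (V - X)) \<le> card (\<Union>(N ` Z) \<union> suns E (V - (X - Z)) \<union> (suns E (V - X) - Q))"
      using fins by (intro card_mono) auto
    also have "\<dots> \<le> card (\<Union>(N ` Z)) + card (suns E (V - (X - Z))) + card (suns E (V - X) - Q)"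
      by (meson card_Un_le add_le_mono1 le_trans)
    finally show ?thesis using d[OF Z False] by linarith
  qed simp
  moreover have "finite (N x)" if "x \<in> X0" for x using finQ by (simp add: N_def)
  ultimately obtain M where M: "\<And>x. x \<in> X0 \<Longrightarrow> M x \<subseteq> N x" "\<And>x. x \<in> X0 \<Longrightarrow> card (M x) = d x"
    "\<And>x y. x \<in> X0 \<Longrightarrow> y \<in> X0 \<Longrightarrow> x \<noteq> y \<Longrightarrow> M x \<inter> M y = {}"
    using hall_demand[of X0 N d] finX by metis
  have NQ: "N x \<subseteq> Q" for x by (auto simp: N_def)
  have sub: "\<Union>(M ` X0) \<subseteq> Q" using M(1) NQ by blast
  have "card (\<Union>(M ` X0)) = (\<Sum>x\<in>X0. card (M x))"
  proof (rule card_UN_disjoint)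
    show "\<forall>x\<in>X0. finite (M x)" using M(1) NQ finQ by (meson finite_subset)
  qed (use finX M(3) in auto)
  then have "card (\<Union>(M ` X0)) = card Q" using M(2) Q(2) by simp
  then have U: "\<Union>(M ` X0) = Q" using sub finQ by (simp add: card_subset_eq)
  have "linked E {x} S" if "x \<in> X0" "S \<in> M x" for x S
    using M(1)[OF that(1)] that(2) by (auto simp: N_def)
  moreover have "M x \<subseteq> Q" if "x \<in> X0" for x using M(1)[OF that] NQ by blast
  ultimately have "sun_assigned E X0 Q d M" using M(2,3) U by (simp add: sun_assigned_def)
  then show ?thesis by blast
qed

text \<open>The set \<open>V\<close> splits into the non-sun components, the groups of a vertex of
  \<open>X1\<close> with its two suns, and an exceptional rest formed by \<open>X2\<close> and
  \<open>Q2\<close>; partitions of these pieces are joined.\<close>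

lemma p3_factorable_assemble:
  assumes "sym E" "finite V" "X \<subseteq> V"
    and nonsun: "\<And>K. K \<in> comps E (V - X) \<Longrightarrow> K \<notin> suns E (V - X) \<Longrightarrow> p3_factorable E K"
    and X: "X = X1 \<union> X2" "X1 \<inter> X2 = {}"
    and Q: "suns E (V - X) = \<Union>(M ` X1) \<union> Q2" "\<Union>(M ` X1) \<inter> Q2 = {}"
    and M: "\<And>x. x \<in> X1 \<Longrightarrow> card (M x) = 2" "\<And>x S. x \<in> X1 \<Longrightarrow> S \<in> M x \<Longrightarrow> linked E {x} S"
      "\<And>x y. x \<in> X1 \<Longrightarrow> y \<in> X1 \<Longrightarrow> x \<noteq> y \<Longrightarrow> M x \<inter> M y = {}"
    and rest: "p3_factorable E (X2 \<union> \<Union>Q2)"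
  shows "p3_factorable E V"
proof -
  let ?C = "comps E (V - X)" and ?S = "suns E (V - X)"
  have finC: "finite ?C" using assms(2) by (simp add: comps_finite)
  have finX1: "finite X1" using assms(2,3) X(1) finite_subset by (metis finite_Un)
  have CU: "\<Union>?C = V - X" using Union_comps[OF assms(1)] assms(2) by blast
  have MS: "M x \<subseteq> ?C" if "x \<in> X1" for x using that Q(1) suns_comps[of E "V - X"] by blast
  have Q2S: "Q2 \<subseteq> ?C" using Q(1) suns_comps[of E "V - X"] by blast
  have MX: "\<Union>(M x) \<inter> X = {}" if "x \<in> X1" for x using MS[OF that] CU by blast
  have 1: "p3_factorable E (\<Union>(?C - ?S))"
  proof -
    have "p3_factorable E (\<Union>(id ` (?C - ?S)))"
      by (rule p3_factorable_UN) (use finC nonsun comps_eqI[of _ E "V - X"] in auto)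
    then show ?thesis by simp
  qed
  have 2: "p3_factorable E (\<Union>x\<in>X1. insert x (\<Union>(M x)))"
  proof (rule p3_factorable_UN[OF finX1])
    fix x assume x: "x \<in> X1"
    obtain S T where ST: "M x = {S, T}" "S \<noteq> T" using M(1)[OF x] by (auto simp: card_2_iff)
    have c: "S \<in> ?C" "T \<in> ?C" using MS[OF x] ST by auto
    have s: "sun E S" "sun E T" using Q(1) x ST by (auto simp: suns_def)
    have "S \<inter> T = {}" using comps_eqI[OF c] ST(2) by blast
    moreover have "x \<notin> S" "x \<notin> T" using comps_subset[OF c(1)] comps_subset[OF c(2)] x X(1) by auto
    moreover have "linked E {x} S" "linked E {x} T" using M(2)[OF x] ST by auto
    ultimately have "p3_factorable E (set [x] \<union> S \<union> T)"
      using s by (intro p3_factorable_path_two_suns[OF assms(1)]) (auto simp: is_path_def)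
    moreover have "set [x] \<union> S \<union> T = insert x (\<Union>(M x))" using ST by auto
    ultimately show "p3_factorable E (insert x (\<Union>(M x)))" by simp
  next
    fix x y assume xy: "x \<in> X1" "y \<in> X1" "x \<noteq> y"
    have "\<Union>(M x) \<inter> \<Union>(M y) = {}"
      by (rule Union_comps_disjoint[of _ E "V - X"]) (use MS M(3) xy in auto)
    then show "insert x (\<Union>(M x)) \<inter> insert y (\<Union>(M y)) = {}"
      using MX[OF xy(1)] MX[OF xy(2)] xy X(1) by blast
  qed
  have d1: "\<Union>(?C - ?S) \<inter> (\<Union>x\<in>X1. insert x (\<Union>(M x))) = {}"
  proof -
    have "\<Union>(?C - ?S) \<inter> \<Union>(\<Union>(M ` X1)) = {}"
      by (rule Union_comps_disjoint[of _ E "V - X"]) (use MS Q(1) in auto)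
    moreover have "\<Union>(?C - ?S) \<inter> X1 = {}" using CU X(1) by blast
    ultimately show ?thesis by blast
  qed
  have d2: "(\<Union>(?C - ?S) \<union> (\<Union>x\<in>X1. insert x (\<Union>(M x)))) \<inter> (X2 \<union> \<Union>Q2) = {}"
  proof -
    have "\<Union>(?C - ?S) \<inter> \<Union>Q2 = {}"
      by (rule Union_comps_disjoint[of _ E "V - X"]) (use Q2S Q(1) in auto)
    moreover have "\<Union>(\<Union>(M ` X1)) \<inter> \<Union>Q2 = {}"
      by (rule Union_comps_disjoint[of _ E "V - X"]) (use Q2S MS Q(2) in auto)
    moreover have "\<Union>(?C - ?S) \<inter> X2 = {}" "X1 \<inter> \<Union>Q2 = {}" "\<Union>(\<Union>(M ` X1)) \<inter> X2 = {}"
      using CU X(1) Q2S MX by blast+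
    moreover have "(\<Union>x\<in>X1. insert x (\<Union>(M x))) = X1 \<union> \<Union>(\<Union>(M ` X1))" by auto
    ultimately show ?thesis using X(2) by (simp only: Int_Un_distrib Int_Un_distrib2) simp
  qed
  have "\<Union>(?C - ?S) \<union> (\<Union>x\<in>X1. insert x (\<Union>(M x))) \<union> (X2 \<union> \<Union>Q2) = \<Union>(?C - ?S) \<union> \<Union>?S \<union> X"
  proof -
    have "\<Union>?S = \<Union>(\<Union>(M ` X1)) \<union> \<Union>Q2" using Q(1) by auto
    then show ?thesis using X(1) by auto
  qed
  also have "\<dots> = \<Union>?C \<union> X" using suns_comps[of E "V - X"] by blast
  also have "\<dots> = V" using CU assms(3) by blast
  finally show ?thesis using p3_factorable_Un[OF p3_factorable_Un[OF 1 2 d1] rest d2] by simp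
qed

text \<open>As \<open>K\<close> is not a sun, deleting \<open>Y\<close> from it keeps all suns of
  \<open>V - X\<close> and adds those of \<open>K - Y\<close>; the last premise bounds the
  total.\<close>

lemma sun_bounded_comp:
  assumes "finite V" "X \<subseteq> V" "K \<in> comps E (V - X)" "K \<notin> suns E (V - X)"
    and "\<And>Y. Y \<subseteq> K \<Longrightarrow> card (suns E (V - (X \<union> Y))) \<le> card (suns E (V - X)) + 2 * card Y"
  shows "sun_bounded E K"
  unfolding sun_bounded_def
proof (intro allI impI)
  fix Y assume Y: "Y \<subseteq> K"
  have KV: "K \<subseteq> V" using comps_subset[OF assms(3)] by blast
  have "suns E (K - Y) \<union> suns E (V - X) \<subseteq> suns E (V - X - Y)"
    using comps_delete_within[OF assms(3) Y] assms(4) by (auto simp: suns_def)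
  then have "card (suns E (K - Y) \<union> suns E (V - X)) \<le> card (suns E (V - X - Y))"
    using assms(1) by (intro card_mono suns_finite) auto
  moreover have "suns E (K - Y) \<inter> suns E (V - X) = {}"
  proof (rule ccontr)
    assume "suns E (K - Y) \<inter> suns E (V - X) \<noteq> {}"
    then obtain S where S: "S \<in> comps E (K - Y)" "S \<in> suns E (V - X)" by (auto simp: suns_def)
    then have "S \<inter> K \<noteq> {}" using comps_subset comps_nonempty by fastforce
    then have "S = K" using comps_eqI[of S E "V - X" K] S(2) assms(3) by (auto simp: suns_def)
    then show False using S(2) assms(4) by simp
  qed
  then have "card (suns E (K - Y) \<union> suns E (V - X)) = card (suns E (K - Y)) + card (suns E (V - X))"
    using assms(1) KV by (intro card_Un_disjoint suns_finite) (auto intro: finite_subset)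
  moreover have "V - X - Y = V - (X \<union> Y)" by blast
  ultimately show "card (suns E (K - Y)) \<le> 2 * card Y" using assms(5)[OF Y] by simp
qed

section \<open>Suns created by deleting one edge\<close>

lemma sun_delete_edge:
  assumes "sun (E - {(a, b), (b, a)}) S" "a \<notin> S" "b \<notin> S"
  shows "sun E S"
proof (cases "\<exists>v. S = {v}")
  case True then show ?thesis by (simp add: sun_def)
next
  case False
  then obtain R l where c: "corona (E - {(a, b), (b, a)}) S R l" using assms by (auto simp: sun_def)
  have "p3_factorable E (S - {r, l r})" if "r \<in> R" for r
    using c that p3_factorable_mono[of "E - {(a, b), (b, a)}" _ E] by (auto simp: corona_def)
  moreover have "(l r, y) \<in> E \<longleftrightarrow> (l r, y) \<in> E - {(a, b), (b, a)}" if "r \<in> R" for r y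
  proof -
    have "l r \<in> S" using c that by (auto simp: corona_def)
    then show ?thesis using assms by auto
  qed
  ultimately have "corona E S R l" using c by (simp add: corona_def)
  then show ?thesis by (auto simp: sun_def)
qed

lemma card_comps_containing:
  "finite A \<Longrightarrow> card {S \<in> comps E A. a \<in> S \<or> b \<in> S} \<le> 2"
proof -
  assume fin: "finite A"
  have 1: "card {S \<in> comps E A. c \<in> S} \<le> 1" for c
    using comps_finite[OF fin] comps_eqI[of _ E A] by (intro card_le_Suc0_iff_eq[THEN iffD2, simplified One_nat_def[symmetric]]) auto
  have "card {S \<in> comps E A. a \<in> S \<or> b \<in> S} = card ({S \<in> comps E A. a \<in> S} \<union> {S \<in> comps E A. b \<in> S})"
    by (rule arg_cong[of _ _ card]) auto
  also have "\<dots> \<le> card {S \<in> comps E A. a \<in> S} + card {S \<in> comps E A. b \<in> S}" by (rule card_Un_le)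
  finally show ?thesis using 1[of a] 1[of b] by linarith
qed

text \<open>A sun that contains neither end of the edge is a sun already before the deletion, and at
  most two components contain an end.\<close>

lemma card_suns_delete_edge:
  assumes "finite A"
  shows "card (suns (E - {(a, b), (b, a)}) A) \<le> card (suns E A) + 2"
proof -
  let ?E = "E - {(a, b), (b, a)}"
  have "suns ?E A \<subseteq> suns E A \<union> {S \<in> comps ?E A. a \<in> S \<or> b \<in> S}"
    using comps_delete_edge[of _ E a b A] sun_delete_edge[of E a b] by (auto simp: suns_def)
  then have "card (suns ?E A) \<le> card (suns E A \<union> {S \<in> comps ?E A. a \<in> S \<or> b \<in> S})"
    using assms by (intro card_mono) (auto simp: suns_finite comps_finite)
  also have "\<dots> \<le> card (suns E A) + card {S \<in> comps ?E A. a \<in> S \<or> b \<in> S}" by (rule card_Un_le)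
  finally show ?thesis using card_comps_containing[OF assms, of ?E a b] by linarith
qed

text \<open>A one-vertex sun can have lost only its edge to the other end. In a corona, a pendant
  vertex that is not an end of the deleted edge still has its only neighbour.\<close>

lemma deleted_edge_sun_leaf:
  assumes "irrefl E" "a \<in> V" "b \<in> V" "a \<noteq> b" "S \<in> suns (E - {(a, b), (b, a)}) V"
  obtains l r where "l \<in> V" "r \<in> V" "l \<noteq> r" "\<And>y. y \<in> V \<Longrightarrow> (l, y) \<in> E \<Longrightarrow> y = r"
proof -
  let ?E = "E - {(a, b), (b, a)}"
  have SV: "S \<subseteq> V" and cl: "\<And>s y. s \<in> S \<Longrightarrow> y \<in> V \<Longrightarrow> (s, y) \<in> ?E \<Longrightarrow> y \<in> S" and s: "sun ?E S"
    using assms(5) by (auto simp: suns_def comps_def linked_def)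
  show ?thesis
  proof (cases "\<exists>v. S = {v}")
    case True
    then obtain v where v: "S = {v}" by blast
    have nb: "y = v \<or> (v, y) \<in> {(a, b), (b, a)}" if "y \<in> V" "(v, y) \<in> E" for y
      using cl[of v y] v that by auto
    have "v \<in> V" using SV v by simp
    moreover have "(v, v) \<notin> E" using assms(1) by (simp add: irrefl_def)
    ultimately have nb': "y = (if v = a then b else a)" if "y \<in> V" "(v, y) \<in> E" for y
      using nb[OF that] that(2) by auto
    show ?thesis
      by (rule that[of v "if v = a then b else a"]) (use nb' \<open>v \<in> V\<close> assms(2-4) in auto)
  next
    case False
    then obtain R l where c: "corona ?E S R l" using s by (auto simp: sun_def)
    have S: "S = R \<union> l ` R" "R \<inter> l ` R = {}" "inj_on l R" "finite R" "R \<noteq> {}" "card R \<noteq> 2"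
      and lE: "\<And>r y. r \<in> R \<Longrightarrow> y \<in> S \<Longrightarrow> (l r, y) \<in> ?E \<longleftrightarrow> y = r"
      using c by (auto simp: corona_def)
    show ?thesis
    proof (cases "\<exists>r\<in>R. l r \<notin> {a, b}")
      case True
      then obtain r where r: "r \<in> R" "l r \<notin> {a, b}" by blast
      have "l r \<in> S" "r \<in> S" using r S by auto
      moreover have "l r \<noteq> r" using S(2) r(1) by force
      moreover have "y = r" if "y \<in> V" "(l r, y) \<in> E" for y
        using cl[of "l r" y] lE[of r y] r that \<open>l r \<in> S\<close> by auto
      ultimately show ?thesis using that[of "l r" r] SV by auto
    next
      \<comment> \<open>All pendant vertices are ends of the deleted edge, so there are at most two.
        As \<open>card R = 2\<close> is excluded, the sun is a single edge. This edge was not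
        deleted, so \<open>r\<close> is not an end, and \<open>r\<close> is itself pendant at
        \<open>l r\<close>.\<close>
      case False
      then have "l ` R \<subseteq> {a, b}" by blast
      then have "card (l ` R) \<le> 2" using card_mono[of "{a, b}" "l ` R"] assms(4) by simp
      then have "card R \<le> 2" using S(3) by (simp add: card_image)
      moreover have "card R \<noteq> 0" using S(4,5) by simp
      ultimately have "card R = 1" using S(6) by linarith
      then obtain r where R: "R = {r}" by (auto simp: card_1_singleton_iff)
      have Sr: "S = {r, l r}" "l r \<noteq> r" using R S by auto
      have e: "(l r, r) \<in> ?E" using lE[of r r] R Sr by simp
      have rab: "r \<notin> {a, b}" using e False R Sr(2) by auto
      have "y = l r" if "y \<in> V" "(r, y) \<in> E" for y
      proof -
        have "y \<in> S" using cl[of r y] Sr rab that by auto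
        then show ?thesis using Sr(1) that(2) assms(1) by (auto simp: irrefl_def)
      qed
      then show ?thesis using that[of r "l r"] Sr SV by auto
    qed
  qed
qed

text \<open>The induction runs over \<open>card V + card E\<close>, because some steps pass to a
  smaller vertex set and \<open>leaf_exists\<close> passes to a smaller edge set.\<close>

locale kaneko_step =
  fixes E :: "('a \<times> 'a) set" and V :: "'a set"
  assumes symE: "sym E" and irreflE: "irrefl E" and finE: "finite E" and finV: "finite V"
    and bounded: "sun_bounded E V"
    and smaller: "\<And>(E' :: ('a \<times> 'a) set) V'. sym E' \<Longrightarrow> irrefl E' \<Longrightarrow> finite E' \<Longrightarrow> finite V' \<Longrightarrow> sun_bounded E' V' \<Longrightarrow>
      card V' + card E' < card V + card E \<Longrightarrow> p3_factorable E' V'"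
begin

lemma smaller_set: "A \<subset> V \<Longrightarrow> sun_bounded E A \<Longrightarrow> p3_factorable E A"
  using smaller[of E A] symE irreflE finE finV psubset_card_mono[of V A]
  by (auto intro: finite_subset)

lemma suns_empty: "suns E V = {}"
proof -
  have "card (suns E (V - {})) \<le> 2 * card ({} :: 'a set)"
    using bounded unfolding sun_bounded_def by blast
  then show ?thesis using suns_finite[OF finV] by simp
qed

text \<open>Here \<open>k\<close> is the deficiency of \<open>X\<close> in the bound, and no
  superset of \<open>X\<close> has a smaller one. Hence deleting \<open>Y\<close> from
  \<open>K\<close> adds at most \<open>2 * card Y\<close> suns, and the induction hypothesis applies
  to \<open>K\<close>. The second premise makes \<open>K\<close> a proper subset of
  \<open>V\<close>.\<close>

lemma nonsun_comp_factorable: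
  assumes "X \<subseteq> V" "X \<noteq> {} \<or> \<not> cut_connected E V" "card (suns E (V - X)) + k = 2 * card X"
    and le: "\<And>X'. X \<subseteq> X' \<Longrightarrow> X' \<subseteq> V \<Longrightarrow> card (suns E (V - X')) + k \<le> 2 * card X'"
    and K: "K \<in> comps E (V - X)" "K \<notin> suns E (V - X)"
  shows "p3_factorable E K"
proof (rule smaller_set)
  have KV: "K \<subseteq> V - X" using comps_subset[OF K(1)] .
  show "K \<subset> V"
  proof (cases "X = {}")
    case True
    then have "\<not> cut_connected E V" "cut_connected E K" using assms(2) K(1) by (auto simp: comps_def)
    then show ?thesis using KV by blast
  next
    case False
    then show ?thesis using KV assms(1) by blast
  qed
  show "sun_bounded E K"
  proof (rule sun_bounded_comp[OF finV assms(1) K])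
    fix Y assume Y: "Y \<subseteq> K"
    have "card (suns E (V - (X \<union> Y))) + k \<le> 2 * card (X \<union> Y)"
      using Y KV assms(1) by (intro le) auto
    also have "\<dots> \<le> 2 * card X + 2 * card Y" using card_Un_le[of X Y] by linarith
    finally show "card (suns E (V - (X \<union> Y))) \<le> card (suns E (V - X)) + 2 * card Y"
      using assms(3) by linarith
  qed
qed

text \<open>With equality, Hall's condition for \<open>Z\<close> with demand two is just the bound
  for \<open>X - Z\<close>, and the suns are used up exactly. The case \<open>X = {}\<close> splits
  a disconnected \<open>V\<close> into its components.\<close>

lemma tight_factorable:
  assumes X: "X \<subseteq> V" "X \<noteq> {} \<or> \<not> cut_connected E V" "card (suns E (V - X)) = 2 * card X"
  shows "p3_factorable E V"
proof -
  have finX: "finite X" using X finV finite_subset by blast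
  have le: "card (suns E (V - X')) \<le> 2 * card X'" if "X' \<subseteq> V" for X'
    using bounded that by (simp add: sun_bounded_def)
  have "\<exists>M. sun_assigned E X (suns E (V - X)) (\<lambda>_. 2) M"
  proof (rule sun_assignment[OF symE finV X(1) subset_refl subset_refl])
    show "(\<Sum>x\<in>X. 2) = card (suns E (V - X))" using X(3) by simp
    fix Z assume Z: "Z \<subseteq> X" "Z \<noteq> {}"
    have "card Z + card (X - Z) = card X"
      using Z finX by (metis card_Diff_subset card_mono finite_subset le_add_diff_inverse)
    moreover have "card (suns E (V - (X - Z))) \<le> 2 * card (X - Z)" using le X(1) by blast
    ultimately show "(\<Sum>x\<in>Z. 2) + card (suns E (V - (X - Z))) + card (suns E (V - X) - suns E (V - X))
        \<le> card (suns E (V - X))" using X(3) by simp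
  qed
  then obtain M where "sun_assigned E X (suns E (V - X)) (\<lambda>_. 2) M" by blast
  note M = sun_assignedD[OF this]
  show ?thesis
  proof (rule p3_factorable_assemble[OF symE finV X(1), of X "{}" M "{}"])
    fix K assume K: "K \<in> comps E (V - X)" "K \<notin> suns E (V - X)"
    show "p3_factorable E K"
      by (rule nonsun_comp_factorable[OF X(1,2), of 0]) (use X(3) le K in auto)
  qed (use M p3_factorable_empty in simp_all)
qed

end

text \<open>
  The assumptions of this locale are contradictory: they force \<open>V\<close> itself to be a sun, against
  \<open>sun_bounded E V\<close> for the empty set.
\<close>

locale kaneko_strict = kaneko_step +
  assumes connected: "cut_connected E V"
    and strict: "\<And>X. X \<subseteq> V \<Longrightarrow> X \<noteq> {} \<Longrightarrow> card (suns E (V - X)) < 2 * card X"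
    and not_factorable: "\<not> p3_factorable E V"
begin

text \<open>That \<open>l\<close> and \<open>r\<close> are adjacent follows from connectedness, see
  \<open>leaf_edge\<close>.\<close>

definition leaf :: "'a \<Rightarrow> 'a \<Rightarrow> bool" where
  "leaf l r \<longleftrightarrow> l \<in> V \<and> r \<in> V \<and> l \<noteq> r \<and> (\<forall>y\<in>V. (l, y) \<in> E \<longrightarrow> y = r)"

lemma leaf_edge: "leaf l r \<Longrightarrow> (l, r) \<in> E"
proof -
  assume l: "leaf l r"
  then have "{l} \<subset> V" by (auto simp: leaf_def)
  then have "linked E {l} (V - {l})" using connected by (auto simp: cut_connected_def)
  then show ?thesis using l by (auto simp: linked_def leaf_def)
qed

lemma leaf_sun: "leaf l r \<Longrightarrow> r \<in> X \<Longrightarrow> l \<notin> X \<Longrightarrow> {l} \<in> suns E (V - X)"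
  by (rule suns_singleton) (auto simp: leaf_def)

text \<open>
  Take the tight set \<open>Y\<close> containing \<open>w\<close> minimal. Then any sun \<open>s\<close> adjacent to \<open>w\<close> can be given to \<open>w\<close>
  while the remaining suns are shared out two per vertex of \<open>Y - {w}\<close>. If \<open>s\<close> is not a single vertex,
  \<open>w\<close> and \<open>s\<close> contain a long enough path. If \<open>Y\<close> has a second vertex, \<open>w\<close> is adjacent to another
  one-vertex sun \<open>t\<close>, given to \<open>y\<close> say, and the path \<open>s - w - t - y - u\<close> repairs the partition.
\<close>

lemma tight_leaf:
  assumes "X \<subseteq> V" "w \<in> X" "card (suns E (V - X)) + 1 = 2 * card X"
  shows "\<exists>l. leaf l w"
proof -
  define P where "P Y \<longleftrightarrow> Y \<subseteq> V \<and> w \<in> Y \<and> card (suns E (V - Y)) + 1 = 2 * card Y" for Y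
  have "P X" using assms by (simp add: P_def)
  then obtain Y where PY: "P Y" and min: "\<And>Z. P Z \<Longrightarrow> card Y \<le> card Z"
    using ex_has_least_nat[of P X card] by blast
  have Y: "Y \<subseteq> V" "w \<in> Y" "card (suns E (V - Y)) + 1 = 2 * card Y" using PY by (auto simp: P_def)
  have finY: "finite Y" using Y(1) finV finite_subset by blast
  let ?S = "suns E (V - Y)"
  have finS: "finite ?S" using finV by (simp add: suns_finite)
  \<comment> \<open>Minimality of \<open>Y\<close> excludes deficiency one and strictness excludes
    zero. The resulting slack of two pays for the sun \<open>s\<close> withheld in
    \<open>assign\<close>.\<close>
  have lt: "card (suns E (V - Z)) + 2 \<le> 2 * card Z" if "Z \<subset> Y" "w \<in> Z" for Z
  proof -
    have "card Z < card Y" using that(1) finY psubset_card_mono by blast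
    then have "\<not> P Z" using min[of Z] by auto
    moreover have "card (suns E (V - Z)) < 2 * card Z" using strict[of Z] that Y(1) by blast
    ultimately show ?thesis using that Y(1) unfolding P_def by auto
  qed
  have assign: "\<exists>M. sun_assigned E (Y - {w}) (?S - {s}) (\<lambda>_. 2) M" if s: "s \<in> ?S" for s
  proof -
    have cw: "card (Y - {w}) + 1 = card Y" using Y(2) finY by (metis Suc_eq_plus1 card_Suc_Diff1)
    have cs: "card (?S - {s}) + 1 = card ?S" using s finS by (metis Suc_eq_plus1 card_Suc_Diff1)
    show ?thesis
    proof (rule sun_assignment[OF symE finV Y(1), of "Y - {w}" "?S - {s}"])
      show "(\<Sum>x\<in>Y - {w}. 2) = card (?S - {s})" using cs cw Y(3) by simp
      fix Z assume Z: "Z \<subseteq> Y - {w}" "Z \<noteq> {}"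
      have "card Z + card (Y - Z) = card Y"
        using Z finY by (metis card_Diff_subset card_mono finite_Diff finite_subset le_add_diff_inverse subset_trans Diff_subset)
      moreover have "card (suns E (V - (Y - Z))) + 2 \<le> 2 * card (Y - Z)" using Z Y(2) by (intro lt) auto
      moreover have "?S - (?S - {s}) = {s}" using s by blast
      ultimately show "(\<Sum>x\<in>Z. 2) + card (suns E (V - (Y - Z))) + card (?S - (?S - {s})) \<le> card ?S"
        using Y(3) by simp
    qed auto
  qed
  have nonsun: "p3_factorable E K" if "K \<in> comps E (V - Y)" "K \<notin> ?S" for K
  proof (rule nonsun_comp_factorable[OF Y(1) _ Y(3) _ that])
    show "Y \<noteq> {} \<or> \<not> cut_connected E V" using Y(2) by blast
    show "card (suns E (V - X')) + 1 \<le> 2 * card X'" if "Y \<subseteq> X'" "X' \<subseteq> V" for X'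
      using strict[of X'] that Y(2) by fastforce
  qed
  have wS: "w \<notin> S" if "S \<in> ?S" for S using that Y(2) comps_subset[of S E "V - Y"] by (auto simp: suns_def)
  have small: "card s = 1" if s: "s \<in> ?S" "linked E {w} s" for s
  proof (rule ccontr)
    assume big: "card s \<noteq> 1"
    obtain M where "sun_assigned E (Y - {w}) (?S - {s}) (\<lambda>_. 2) M" using assign[OF s(1)] by blast
    note M = sun_assignedD[OF this]
    have "p3_factorable E V"
    proof (rule p3_factorable_assemble[OF symE finV Y(1) nonsun, of "Y - {w}" "{w}" M "{s}"])
      show "p3_factorable E ({w} \<union> \<Union>{s})"
        using p3_factorable_path_big_sun[OF symE _ big s(2) wS[OF s(1)]] s(1) by (simp add: suns_def)
      show "?S = \<Union>(M ` (Y - {w})) \<union> {s}" unfolding M(5) using s(1) by blast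
    qed (use M Y(2) in auto)
    then show False using not_factorable by simp
  qed
  have nbrs: "?S \<subseteq> {s \<in> ?S. linked E {w} s} \<union> suns E (V - (Y - {w}))"
  proof
    fix s assume s: "s \<in> ?S"
    show "s \<in> {s \<in> ?S. linked E {w} s} \<union> suns E (V - (Y - {w}))"
    proof (cases "linked E {w} s")
      case False
      then have "\<not> linked E s (V - (Y - {w}) - (V - Y))"
        using linked_sym[OF symE, of "{w}" s] by (auto simp: linked_def)
      then show ?thesis using suns_unlinked_extend[OF s, of "V - (Y - {w})"] by auto
    qed (use s in simp)
  qed
  have Yw: "Y = {w}"
  proof (rule ccontr)
    assume "Y \<noteq> {w}"
    then have ne: "Y - {w} \<noteq> {}" using Y(2) by blast
    have cw: "card (Y - {w}) + 1 = card Y" using Y(2) finY by (metis Suc_eq_plus1 card_Suc_Diff1)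
    \<comment> \<open>There are \<open>2 * card Y - 1\<close> suns. By strictness fewer than
      \<open>2 * card Y - 2\<close> of them survive putting \<open>w\<close> back, so at least two
      are adjacent to \<open>w\<close>.\<close>
    have "card ?S \<le> card ({s \<in> ?S. linked E {w} s} \<union> suns E (V - (Y - {w})))"
      using nbrs finS finV by (intro card_mono) (auto simp: suns_finite)
    also have "\<dots> \<le> card {s \<in> ?S. linked E {w} s} + card (suns E (V - (Y - {w})))" by (rule card_Un_le)
    finally have two: "card {s \<in> ?S. linked E {w} s} \<ge> 2"
      using strict[OF _ ne] Y(1,3) cw by fastforce
    obtain s t where st: "s \<in> ?S" "linked E {w} s" "t \<in> ?S" "linked E {w} t" "s \<noteq> t"
    proof -
      obtain A where "A \<subseteq> {s \<in> ?S. linked E {w} s}" "card A = 2"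
        by (rule obtain_subset_with_card_n[OF two])
      then obtain s t where "{s, t} \<subseteq> {s \<in> ?S. linked E {w} s}" "s \<noteq> t" by (auto simp: card_2_iff)
      then show thesis using that[of s t] by auto
    qed
    obtain M where "sun_assigned E (Y - {w}) (?S - {s}) (\<lambda>_. 2) M" using assign[OF st(1)] by blast
    note M = sun_assignedD[OF this]
    have "t \<in> \<Union>(M ` (Y - {w}))" unfolding M(5) using st by blast
    then obtain y where y: "y \<in> Y - {w}" "t \<in> M y" by blast
    have "card (M y) = 2" using M(2) y by blast
    then have "card (M y - {t}) = 1" using y(2) by simp
    then obtain u where "M y - {t} = {u}" by (auto simp: card_1_singleton_iff)
    then have u: "M y = {t, u}" "u \<noteq> t" using y(2) by blast+
    obtain t0 where t0: "t = {t0}" using small[OF st(3,4)] by (auto simp: card_1_singleton_iff)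
    have uS: "u \<in> ?S" "u \<noteq> s" using M(1)[OF y(1)] u(1) by auto
    have lk: "linked E {y} t" "linked E {y} u" using M(3)[OF y(1)] u(1) by auto
    have e: "(w, t0) \<in> E" "(t0, y) \<in> E" using st(4) lk(1) t0 symE by (auto simp: linked_def dest: symD)
    have sub: "S \<subseteq> V - Y" if "S \<in> ?S" for S using that comps_subset by (auto simp: suns_def)
    have dj: "S \<inter> T = {}" if "S \<in> ?S" "T \<in> ?S" "S \<noteq> T" for S T
      using that comps_eqI[of S E "V - Y" T] by (auto simp: suns_def)
    have t0n: "t0 \<notin> Y" "t0 \<notin> s" "t0 \<notin> u"
      using sub[OF st(3)] dj[OF st(3,1)] dj[OF st(3) uS(1)] st(5) u(2) t0 by auto
    have "p3_factorable E (set [w, t0, y] \<union> s \<union> u)"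
    proof (rule p3_factorable_path_two_suns[OF symE])
      show "is_path E [w, t0, y]" using e y(1) Y(2) t0n(1) by (auto simp: is_path_def)
      show "sun E s" "sun E u" using st(1) uS(1) by (auto simp: suns_def)
      show "set [w, t0, y] \<inter> s = {}" "set [w, t0, y] \<inter> u = {}"
        using sub[OF st(1)] sub[OF uS(1)] y(1) Y(2) t0n by auto
      show "s \<inter> u = {}" using dj st(1) uS by blast
    qed (use st lk in auto)
    moreover have "{w, y} \<union> \<Union>{s, t, u} = set [w, t0, y] \<union> s \<union> u" using t0 by auto
    ultimately have f: "p3_factorable E ({w, y} \<union> \<Union>{s, t, u})" by simp
    have "p3_factorable E V"
    proof (rule p3_factorable_assemble[OF symE finV Y(1) nonsun _ _ _ _ _ _ _ f, of "Y - {w, y}" M])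
      have "\<Union>(M ` (Y - {w})) = \<Union>(M ` (Y - {w, y})) \<union> M y" using y(1) by auto
      then have "?S - {s} = \<Union>(M ` (Y - {w, y})) \<union> {t, u}" unfolding M(5) u(1) .
      then show "?S = \<Union>(M ` (Y - {w, y})) \<union> {s, t, u}" using st(1) by blast
      have "M x \<inter> {s, t, u} = {}" if "x \<in> Y - {w, y}" for x
      proof -
        have "x \<in> Y - {w}" "x \<noteq> y" using that by auto
        then have "M x \<inter> M y = {}" "M x \<subseteq> ?S - {s}" using M(1,4) y(1) by blast+
        then show ?thesis using u(1) by auto
      qed
      then show "\<Union>(M ` (Y - {w, y})) \<inter> {s, t, u} = {}" by blast
    qed (use M(2,3,4) Y(2) y(1) in auto)
    then show False using not_factorable by simp
  qed
  \<comment> \<open>For \<open>Y = {w}\<close> there is exactly one sun. It is adjacent to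
    \<open>w\<close>, since \<open>V\<close> has no sun, and hence a single vertex. Being a
    component of \<open>V - {w}\<close>, this vertex has no neighbour but \<open>w\<close>.\<close>
  have "card ?S = 1" using Y(3) Yw by simp
  then obtain s where s: "?S = {s}" by (auto simp: card_1_singleton_iff)
  have "suns E (V - (Y - {w})) = {}" using Yw suns_empty by simp
  then have "linked E {w} s" using nbrs s by auto
  then have "card s = 1" using small s by blast
  then obtain l where l: "s = {l}" by (auto simp: card_1_singleton_iff)
  have "{l} \<in> comps E (V - {w})" using s l Yw by (auto simp: suns_def)
  then have c: "l \<in> V - {w}" "\<not> linked E {l} (V - {w} - {l})" by (auto simp: comps_def)
  have "(l, l) \<notin> E" using irreflE by (simp add: irrefl_def)
  then have "leaf l w" using c Y(1,2) by (auto simp: leaf_def linked_def)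
  then show ?thesis by blast
qed

end

context kaneko_strict
begin

lemma not_sun: "\<not> sun E V"
  using suns_empty comps_connected[OF connected] by (auto simp: suns_def)

text \<open>Strictness excludes deficiency zero and \<open>tight_leaf\<close> excludes deficiency
  one.\<close>

lemma no_leaf_slack:
  assumes "X \<subseteq> V" "w \<in> X" "\<nexists>l. leaf l w"
  shows "card (suns E (V - X)) + 2 \<le> 2 * card X"
proof -
  have "card (suns E (V - X)) + 1 \<noteq> 2 * card X" using tight_leaf[OF assms(1,2)] assms(3) by blast
  moreover have "card (suns E (V - X)) < 2 * card X" using strict[of X] assms(1,2) by blast
  ultimately show ?thesis by linarith
qed

text \<open>
  Deleting an edge creates at most two suns, so without leaves the bound survives the deletion.
\<close>

lemma leaf_exists: "\<exists>l r. leaf l r"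
proof (rule ccontr)
  assume no: "\<nexists>l r. leaf l r"
  obtain a where a: "a \<in> V" using connected by (auto simp: cut_connected_def)
  have "V \<noteq> {a}" using not_sun by (auto simp: sun_def)
  then have "linked E {a} (V - {a})" using a connected by (auto simp: cut_connected_def)
  then obtain b where b: "b \<in> V" "a \<noteq> b" "(a, b) \<in> E" by (auto simp: linked_def)
  let ?E = "E - {(a, b), (b, a)}"
  have "p3_factorable ?E V"
  proof (rule smaller)
    show "sym ?E" using symE by (auto simp: sym_def)
    show "irrefl ?E" using irreflE by (auto simp: irrefl_def)
    show "finite ?E" "finite V" using finE finV by auto
    have "?E \<subset> E" using b by blast
    then show "card V + card ?E < card V + card E" using finE by (simp add: psubset_card_mono)
    show "sun_bounded ?E V"
      unfolding sun_bounded_def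
    proof (intro allI impI)
      fix X assume X: "X \<subseteq> V"
      show "card (suns ?E (V - X)) \<le> 2 * card X"
      proof (cases "X = {}")
        \<comment> \<open>The empty set contains no \<open>w\<close> to supply the slack; here a sun
          would itself yield a leaf.\<close>
        case True
        have "suns ?E V = {}"
        proof (rule ccontr)
          assume "suns ?E V \<noteq> {}"
          then obtain S where S: "S \<in> suns ?E V" by blast
          obtain l r where lr: "l \<in> V" "r \<in> V" "l \<noteq> r" "\<And>y. y \<in> V \<Longrightarrow> (l, y) \<in> E \<Longrightarrow> y = r"
            using deleted_edge_sun_leaf[OF irreflE a b(1,2) S] by metis
          then have "leaf l r" by (auto simp: leaf_def)
          then show False using no by blast
        qed
        then show ?thesis using True by simp
      next
        case False
        then obtain w where "w \<in> X" by blast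
        then have "card (suns E (V - X)) + 2 \<le> 2 * card X" using no_leaf_slack[OF X] no by blast
        then show ?thesis using card_suns_delete_edge[of "V - X" E a b] finV by simp
      qed
    qed
  qed
  then have "p3_factorable E V" by (rule p3_factorable_mono) blast
  then show False using not_factorable by simp
qed

section \<open>Spreading leaves from one vertex to the whole graph\<close>

lemma leaf_unlinked:
  assumes "leaf l r" "r \<notin> A" "A \<subseteq> V"
  shows "\<not> linked E A {l}"
  using assms symD[OF symE] by (auto simp: linked_def leaf_def)

text \<open>With \<open>r\<close> deleted, \<open>l\<close> is isolated, so putting \<open>l\<close>
  back adds the sun \<open>{l}\<close> and disturbs no other.\<close>

lemma suns_add_leaf:
  assumes "leaf l r" "r \<in> X" "X \<subseteq> V" "l \<notin> X"
  shows "card (suns E (V - X - {l})) + 1 \<le> card (suns E (V - X))"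
proof -
  have "S \<in> suns E (V - X)" if S: "S \<in> suns E (V - X - {l})" for S
  proof (rule suns_unlinked_extend[OF S])
    have SV: "S \<subseteq> V - X - {l}" using S comps_subset by (auto simp: suns_def)
    have "V - X - (V - X - {l}) \<subseteq> {l}" by blast
    moreover have "\<not> linked E S {l}" using SV assms(2) by (intro leaf_unlinked[OF assms(1)]) auto
    ultimately show "\<not> linked E S (V - X - (V - X - {l}))" using linked_mono by blast
  qed auto
  then have "insert {l} (suns E (V - X - {l})) \<subseteq> suns E (V - X)"
    using leaf_sun[OF assms(1,2,4)] by blast
  then have "card (insert {l} (suns E (V - X - {l}))) \<le> card (suns E (V - X))"
    using finV by (intro card_mono) (auto simp: suns_finite)
  moreover have "{l} \<notin> suns E (V - X - {l})" using comps_subset[of "{l}" E "V - X - {l}"] by (auto simp: suns_def)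
  ultimately show ?thesis using suns_finite[of "V - X - {l}" E] finV by simp
qed

text \<open>
  If \<open>w\<close> has no leaf, either \<open>l - r - w\<close> can be split off, or there is a set \<open>X\<close> containing \<open>r\<close> and
  \<open>w\<close> with \<open>2 * card X - 2\<close> suns; then \<open>r\<close> and \<open>w\<close> get one sun each and the edge between them joins
  the two arms.
\<close>

lemma leaf_neighbour:
  assumes "leaf l r" "(r, w) \<in> E" "w \<in> V" "w \<noteq> l"
  shows "\<exists>l'. leaf l' w"
proof (rule ccontr)
  assume no: "\<nexists>l'. leaf l' w"
  have lr: "l \<in> V" "r \<in> V" "l \<noteq> r" using assms(1) by (auto simp: leaf_def)
  have rw: "r \<noteq> w" using assms(2) irreflE by (auto simp: irrefl_def)
  define D where "D = V - {l, r, w}"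
  have "p3_factorable E V"
  proof (cases "sun_bounded E D")
    case True
    have "p3_factorable E D" using True lr by (intro smaller_set) (auto simp: D_def)
    moreover have "p3_factorable E (set [l, r, w])"
      using leaf_edge[OF assms(1)] assms(2,4) lr rw by (intro p3_factorable_path) (auto simp: is_path_def)
    ultimately have "p3_factorable E (D \<union> set [l, r, w])" by (rule p3_factorable_Un) (auto simp: D_def)
    moreover have "D \<union> set [l, r, w] = V" using lr assms(3) by (auto simp: D_def)
    ultimately show ?thesis by simp
  next
    case False
    then obtain Y where Y: "Y \<subseteq> D" "2 * card Y < card (suns E (D - Y))"
      by (auto simp: sun_bounded_def not_le)
    define X where "X = insert r (insert w Y)"
    have finY: "finite Y" using Y(1) finV finite_subset[of Y V] by (auto simp: D_def)
    have XV: "X \<subseteq> V" using Y(1) lr assms(3) by (auto simp: X_def D_def)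
    have finX: "finite X" using finY by (simp add: X_def)
    have "r \<notin> Y" "w \<notin> Y" using Y(1) by (auto simp: D_def)
    then have cX: "card X = card Y + 2" using finY rw by (simp add: X_def)
    \<comment> \<open>A violating \<open>Y\<close> leaves at least \<open>2 * card Y + 1\<close>
      suns, and \<open>{l}\<close> is one more. This reaches \<open>2 * card X - 2\<close>, the most
      that \<open>no_leaf_slack\<close> allows.\<close>
    have "card (suns E (V - X - {l})) + 1 \<le> card (suns E (V - X))"
      by (rule suns_add_leaf[OF assms(1)]) (use XV Y(1) assms(4) lr in \<open>auto simp: X_def D_def\<close>)
    moreover have "V - X - {l} = D - Y" by (auto simp: X_def D_def)
    moreover have up: "card (suns E (V - Z)) + 2 \<le> 2 * card Z" if "Z \<subseteq> V" "w \<in> Z" for Z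
      by (rule no_leaf_slack[OF that no])
    moreover have "w \<in> X" by (simp add: X_def)
    ultimately have tight: "card (suns E (V - X)) + 2 = 2 * card X" using up[OF XV] Y(2) cX by fastforce
    let ?S = "suns E (V - X)"
    define d where "d x = (if x = r \<or> x = w then 1 else 2 :: nat)" for x
    have dsum: "sum d Z + card (Z \<inter> {r, w}) = 2 * card Z" if "finite Z" for Z
      using that
    proof (induction Z rule: finite_induct)
      case (insert x F)
      then show ?case by (cases "x = r \<or> x = w") (auto simp: d_def)
    qed simp
    have "X \<inter> {r, w} = {r, w}" by (auto simp: X_def)
    then have dX: "sum d X + 2 = 2 * card X" using dsum[OF finX] rw by simp
    have "\<exists>M. sun_assigned E X ?S d M"
    proof (rule sun_assignment[OF symE finV XV subset_refl subset_refl])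
      show "sum d X = card ?S" using dX tight by simp
      fix Z assume Z: "Z \<subseteq> X" "Z \<noteq> {}"
      have finZ: "finite Z" using Z finX finite_subset by blast
      have cZ: "card Z + card (X - Z) = card X"
        using Z finX finZ by (metis card_Diff_subset card_mono le_add_diff_inverse)
      \<comment> \<open>Two units have to be saved against \<open>2 * card X\<close>. If
        \<open>w\<close> is in \<open>Z\<close>, its reduced demand saves one and strictness for
        \<open>X - Z\<close> the other; if not, \<open>no_leaf_slack\<close> for
        \<open>X - Z\<close> saves both. For \<open>Z = X\<close> the reduced demands of
        \<open>r\<close> and \<open>w\<close> save two, and \<open>V\<close> has no sun.\<close>
      have "sum d Z + card (suns E (V - (X - Z))) \<le> card ?S"
      proof (cases "X - Z = {}")
        case True
        then have "Z = X" using Z by blast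
        then show ?thesis using suns_empty dX tight by simp
      next
        case ne: False
        show ?thesis
        proof (cases "w \<in> Z")
          case True
          have "card {w} \<le> card (Z \<inter> {r, w})" using True finZ by (intro card_mono) auto
          then have "sum d Z + 1 \<le> 2 * card Z" using dsum[OF finZ] by simp
          moreover have "card (suns E (V - (X - Z))) < 2 * card (X - Z)" using ne XV by (intro strict) auto
          ultimately show ?thesis using cZ tight by linarith
        next
          case False
          have "sum d Z \<le> 2 * card Z" using dsum[OF finZ] by simp
          moreover have "card (suns E (V - (X - Z))) + 2 \<le> 2 * card (X - Z)"
            using False XV by (intro up) (auto simp: X_def)
          ultimately show ?thesis using cZ tight by linarith
        qed
      qed
      then show "sum d Z + card (suns E (V - (X - Z))) + card (?S - ?S) \<le> card ?S" by simp
    qed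
    then obtain M where "sun_assigned E X ?S d M" by blast
    note M = sun_assignedD[OF this]
    have rX: "r \<in> X" and wX: "w \<in> X" by (auto simp: X_def)
    have "card (M r) = 1" "card (M w) = 1" using M(2)[OF rX] M(2)[OF wX] by (auto simp: d_def)
    then obtain s t where s: "M r = {s}" and t: "M w = {t}" by (auto simp: card_1_singleton_iff)
    have st: "s \<in> ?S" "t \<in> ?S" "s \<noteq> t" using M(1)[OF rX] M(1)[OF wX] M(4)[OF rX wX rw] s t by auto
    have sub: "S \<subseteq> V - X" if "S \<in> ?S" for S using that comps_subset by (auto simp: suns_def)
    have "p3_factorable E (set [r, w] \<union> s \<union> t)"
    proof (rule p3_factorable_path_two_suns[OF symE])
      show "is_path E [r, w]" using assms(2) rw by (simp add: is_path_def)
      show "sun E s" "sun E t" using st by (auto simp: suns_def)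
      show "linked E {hd [r, w]} s" "linked E {last [r, w]} t" using M(3)[OF rX] M(3)[OF wX] s t by auto
      show "set [r, w] \<inter> s = {}" "set [r, w] \<inter> t = {}" using sub[OF st(1)] sub[OF st(2)] rX wX by auto
      show "s \<inter> t = {}" using st comps_eqI[of s E "V - X" t] by (auto simp: suns_def)
    qed simp
    moreover have "{r, w} \<union> \<Union>{s, t} = set [r, w] \<union> s \<union> t" by auto
    ultimately have f: "p3_factorable E ({r, w} \<union> \<Union>{s, t})" by simp
    show ?thesis
    proof (rule p3_factorable_assemble[OF symE finV XV _ _ _ _ _ _ _ _ f, of "X - {r, w}" M])
      fix K assume K: "K \<in> comps E (V - X)" "K \<notin> ?S"
      show "p3_factorable E K"
      proof (rule nonsun_comp_factorable[OF XV _ tight _ K])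
        show "X \<noteq> {} \<or> \<not> cut_connected E V" using rX by blast
        show "card (suns E (V - X')) + 2 \<le> 2 * card X'" if "X \<subseteq> X'" "X' \<subseteq> V" for X'
          using up that wX by blast
      qed
    next
      show "X = X - {r, w} \<union> {r, w}" using rX wX by blast
      have "\<Union>(M ` X) = \<Union>(M ` (X - {r, w})) \<union> M r \<union> M w" using rX wX by auto
      then have "?S = \<Union>(M ` (X - {r, w})) \<union> {s} \<union> {t}" unfolding M(5) s t .
      then show "?S = \<Union>(M ` (X - {r, w})) \<union> {s, t}" by (simp add: insert_commute)
      have "M x \<inter> {s, t} = {}" if "x \<in> X - {r, w}" for x
        using M(4)[of x r] M(4)[of x w] that rX wX s t by simp
      then show "\<Union>(M ` (X - {r, w})) \<inter> {s, t} = {}" by blast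
      show "card (M x) = 2" if "x \<in> X - {r, w}" for x using M(2)[of x] that by (simp add: d_def)
      show "linked E {x} S" if "x \<in> X - {r, w}" "S \<in> M x" for x S using M(3)[of x S] that by simp
      show "M x \<inter> M y = {}" if "x \<in> X - {r, w}" "y \<in> X - {r, w}" "x \<noteq> y" for x y
        using M(4)[of x y] that by simp
    qed simp
  qed
  then show False using not_factorable by simp
qed

text \<open>This supplies the last clause of \<open>corona\<close>. Strictness for
  \<open>insert r Y\<close> allows at most \<open>2 * card Y + 1\<close> suns, and one of them is
  \<open>{l}\<close>.\<close>

lemma leaf_deleted_factorable:
  assumes "leaf l r"
  shows "p3_factorable E (V - {r, l})"
proof (rule smaller_set)
  have lr: "l \<in> V" "r \<in> V" "l \<noteq> r" using assms by (auto simp: leaf_def)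
  show "V - {r, l} \<subset> V" using lr by blast
  show "sun_bounded E (V - {r, l})"
    unfolding sun_bounded_def
  proof (intro allI impI)
    fix Y assume Y: "Y \<subseteq> V - {r, l}"
    then have finY: "finite Y" using finV finite_subset by blast
    have "card (suns E (V - insert r Y - {l})) + 1 \<le> card (suns E (V - insert r Y))"
      by (rule suns_add_leaf[OF assms]) (use Y lr in auto)
    moreover have "card (suns E (V - insert r Y)) < 2 * card (insert r Y)"
      using Y lr by (intro strict) auto
    moreover have "card (insert r Y) = card Y + 1" using Y finY by (subst card_insert_disjoint) auto
    moreover have "V - insert r Y - {l} = V - {r, l} - Y" by blast
    ultimately show "card (suns E (V - {r, l} - Y)) \<le> 2 * card Y" by simp
  qed
qed

lemma closed_eq_V:
  assumes "U \<subseteq> V" "U \<noteq> {}" "\<And>u y. u \<in> U \<Longrightarrow> y \<in> V \<Longrightarrow> (u, y) \<in> E \<Longrightarrow> y \<in> U"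
  shows "U = V"
proof (rule ccontr)
  assume "U \<noteq> V"
  then have "linked E U (V - U)" using assms(1,2) connected by (auto simp: cut_connected_def)
  then show False using assms(3) by (auto simp: linked_def)
qed

text \<open>By \<open>leaf_neighbour\<close> the vertices that carry a leaf, together with their
  leaves, are closed under adjacency and so make up \<open>V\<close>. Then \<open>V\<close> is a
  corona, against \<open>not_sun\<close>.\<close>

lemma contradiction: False
proof -
  obtain l0 r0 where l0: "leaf l0 r0" using leaf_exists by blast
  then have V0: "l0 \<in> V" "r0 \<in> V" "l0 \<noteq> r0" by (auto simp: leaf_def)
  have leaf_iff: "(l, y) \<in> E \<longleftrightarrow> y = r" if "leaf l r" "y \<in> V" for l r y
    using leaf_edge[OF that(1)] that by (auto simp: leaf_def)
  show False
  proof (cases "V = {l0, r0}")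
    \<comment> \<open>On two vertices each is a leaf of the other, so \<open>R\<close> would meet
      its leaves; this corona is given by hand.\<close>
    case True
    have "corona E V {r0} (\<lambda>_. l0)"
      unfolding corona_def
      using True V0 leaf_iff[OF l0] by (auto simp: p3_factorable_empty)
    then show False using not_sun by (auto simp: sun_def)
  next
    case big: False
    define R where "R = {r. \<exists>l. leaf l r}"
    define lf where "lf r = (SOME l. leaf l r)" for r
    have lf: "leaf (lf r) r" if "r \<in> R" for r using that someI_ex[of "\<lambda>l. leaf l r"] by (simp add: R_def lf_def)
    have RV: "R \<subseteq> V" "lf ` R \<subseteq> V" using lf by (auto simp: leaf_def)
    \<comment> \<open>If a vertex with a leaf is itself a leaf, the two have no further neighbours
      and exhaust \<open>V\<close>.\<close>
    have disj: "R \<inter> lf ` R = {}"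
    proof (rule ccontr)
      assume "R \<inter> lf ` R \<noteq> {}"
      then obtain r where r: "r \<in> R" "lf r \<in> R" by blast
      let ?l = "lf r"
      have 1: "leaf ?l r" and 2: "leaf (lf ?l) ?l" using lf r by auto
      have "lf ?l = r" using 1 symD[OF symE leaf_edge[OF 2]] 2 by (auto simp: leaf_def)
      then have "{?l, r} = V" using 1 2 by (intro closed_eq_V) (auto simp: leaf_def)
      moreover have "l0 \<in> {?l, r}" "r0 \<in> {?l, r}" using calculation V0 by auto
      ultimately show False using big V0(3) by auto
    qed
    have V: "R \<union> lf ` R = V"
    proof (rule closed_eq_V)
      show "R \<union> lf ` R \<subseteq> V" using RV by blast
      show "R \<union> lf ` R \<noteq> {}" using l0 by (auto simp: R_def)
      fix u y assume u: "u \<in> R \<union> lf ` R" and y: "y \<in> V" "(u, y) \<in> E"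
      from u show "y \<in> R \<union> lf ` R"
      proof
        assume u: "u \<in> R"
        show ?thesis
        proof (cases "y = lf u")
          case False
          then show ?thesis using leaf_neighbour[OF lf[OF u] y(2,1)] by (auto simp: R_def)
        qed (use u in blast)
      next
        assume "u \<in> lf ` R"
        then obtain r where r: "r \<in> R" "u = lf r" by blast
        then show ?thesis using leaf_iff[OF lf[OF r(1)] y(1)] y(2) by simp
      qed
    qed
    have inj: "inj_on lf R"
    proof (rule inj_onI)
      fix x y assume "x \<in> R" "y \<in> R" "lf x = lf y"
      then show "x = y" using leaf_iff[OF lf[of x], of y] leaf_edge[OF lf[of y]] RV by auto
    qed
    \<comment> \<open>Connectedness joins the two vertices of \<open>R\<close>, so their leaves
      extend this edge to a path of order four that covers \<open>V\<close>.\<close>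
    have "card R \<noteq> 2"
    proof
      assume "card R = 2"
      then obtain a b where ab: "R = {a, b}" "a \<noteq> b" by (auto simp: card_2_iff)
      have la: "leaf (lf a) a" and lb: "leaf (lf b) b" using lf ab by auto
      have Vab: "V = {a, b, lf a, lf b}" using V ab by auto
      have dist: "distinct [lf a, a, b, lf b]" using inj disj ab by auto
      have "{a, lf a} \<subset> V" using Vab dist by auto
      then have "linked E {a, lf a} (V - {a, lf a})" using connected by (auto simp: cut_connected_def)
      then obtain u y where uy: "u \<in> {a, lf a}" "y \<in> {b, lf b}" "(u, y) \<in> E" using Vab by (auto simp: linked_def)
      have "(a, b) \<in> E"
      proof -
        have "u = a" using uy leaf_iff[OF la, of y] Vab dist by auto
        moreover have "y \<noteq> lf b" using leaf_iff[OF lb, of a] symD[OF symE uy(3)] calculation Vab dist by auto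
        ultimately show ?thesis using uy by auto
      qed
      then have "is_path E [lf a, a, b, lf b]"
        using dist leaf_edge[OF la] symD[OF symE leaf_edge[OF lb]] by (simp add: is_path_def)
      then have "p3_factorable E (set [lf a, a, b, lf b])" by (rule p3_factorable_path) simp
      moreover have "set [lf a, a, b, lf b] = V" using Vab by auto
      ultimately show False using not_factorable by simp
    qed
    moreover have "finite R" using RV finV finite_subset by blast
    moreover have "R \<noteq> {}" using l0 by (auto simp: R_def)
    ultimately have "corona E V R lf"
      unfolding corona_def using inj disj V lf leaf_iff leaf_deleted_factorable by auto
    then show False using not_sun by (auto simp: sun_def)
  qed
qed

end

text \<open>Sufficiency in Kaneko's theorem. Either \<open>tight_factorable\<close> applies to some
  set, or the situation is that of \<open>kaneko_strict\<close>, which is impossible.\<close>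

theorem sun_bounded_factorable:
  assumes "sym E" "irrefl E" "finite E" "finite V" "sun_bounded E V"
  shows "p3_factorable E V"
  using assms
proof (induction "card V + card E" arbitrary: E V rule: less_induct)
  case less
  interpret kaneko_step E V
    by unfold_locales (use less in auto)
  show ?case
  proof (cases "\<exists>X\<subseteq>V. (X \<noteq> {} \<or> \<not> cut_connected E V) \<and> card (suns E (V - X)) = 2 * card X")
    case True
    then show ?thesis using tight_factorable by blast
  next
    case False
    show ?thesis
    proof (rule ccontr)
      assume nf: "\<not> p3_factorable E V"
      \<comment> \<open>The empty set always attains the bound, because \<open>V\<close> has no sun;
        so only connectedness can have ruled it out.\<close>
      have "cut_connected E V" using False suns_empty by (metis Diff_empty card.empty empty_subsetI mult_0_right)
      moreover have "card (suns E (V - X)) < 2 * card X" if "X \<subseteq> V" "X \<noteq> {}" for X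
        using False that bounded by (metis le_neq_implies_less sun_bounded_def)
      ultimately interpret kaneko_strict E V using nf by unfold_locales
      show False by (rule contradiction)
    qed
  qed
qed

section \<open>Many suns yield many isolated vertices\<close>

text \<open>For \<open>u\<close> in \<open>R\<close>, the choice \<open>T = R\<close> leaves the
  independent set of pendant vertices. If \<open>u\<close> is the pendant vertex of
  \<open>r\<close>, the two are exchanged: \<open>r\<close> stays behind, and it is not adjacent to
  the other pendant vertices.\<close>

lemma corona_split:
  assumes "sym E" "irrefl E" "corona E S R l" "u \<in> S"
  obtains T I where "S = T \<union> I" "T \<inter> I = {}" "u \<in> T" "card T = card I" "I \<noteq> {}"
    "\<And>i y. i \<in> I \<Longrightarrow> y \<in> I \<Longrightarrow> (i, y) \<notin> E"
proof -
  have S: "S = R \<union> l ` R" "R \<inter> l ` R = {}" "inj_on l R" "finite R" "R \<noteq> {}"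
    and lE: "\<And>r y. r \<in> R \<Longrightarrow> y \<in> S \<Longrightarrow> (l r, y) \<in> E \<longleftrightarrow> y = r"
    using assms(3) by (auto simp: corona_def)
  have ll: "(l r, l r') \<notin> E" if "r \<in> R" "r' \<in> R" for r r'
    using lE[of r "l r'"] that S(1,2) by auto
  show ?thesis
  proof (cases "u \<in> R")
    case True
    show ?thesis
    proof (rule that[of R "l ` R"])
      show "card R = card (l ` R)" using S(3) by (simp add: card_image)
    qed (use S True ll in auto)
  next
    case False
    then obtain r where r: "r \<in> R" "u = l r" using assms(4) S(1) by blast
    let ?R = "R - {r}"
    have inj: "inj_on l ?R" using S(3) by (rule inj_on_subset) blast
    have lr: "l r \<notin> l ` ?R" "l r \<notin> R" "r \<notin> l ` R" using S(2,3) r(1) by (auto simp: inj_on_def)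
    have rr: "(l r', r) \<notin> E" "(r, l r') \<notin> E" if "r' \<in> ?R" for r'
    proof -
      show "(l r', r) \<notin> E" using lE[of r' r] that r(1) S(1) by auto
      then show "(r, l r') \<notin> E" using symD[OF assms(1)] by blast
    qed
    have "(r, r) \<notin> E" using assms(2) by (simp add: irrefl_def)
    note nE = this rr ll
    show ?thesis
    proof (rule that[of "insert (l r) ?R" "insert r (l ` ?R)"])
      show "S = insert (l r) ?R \<union> insert r (l ` ?R)" using S(1) r(1) by auto
      show "insert (l r) ?R \<inter> insert r (l ` ?R) = {}" using S(2) lr r(1) by auto
      have "card (insert (l r) ?R) = Suc (card ?R)" using lr S(4) by simp
      moreover have "card (insert r (l ` ?R)) = Suc (card (l ` ?R))"
        using lr(3) S(4) by (subst card_insert_disjoint) auto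
      ultimately show "card (insert (l r) ?R) = card (insert r (l ` ?R))" using inj by (simp add: card_image)
      show "(i, y) \<notin> E" if "i \<in> insert r (l ` ?R)" "y \<in> insert r (l ` ?R)" for i y
        using that nE r(1) by auto
    qed (use r in auto)
  qed
qed

text \<open>A one-vertex sun is isolated at no cost and so gains one. A corona yields as many
  isolated vertices as it costs, and \<open>corona_split\<close> is applied to an end of
  \<open>ab\<close> whenever it contains one.\<close>

lemma sun_split:
  assumes "sym E" "irrefl E" "sun E S"
  shows "\<exists>T I. S = T \<union> I \<and> T \<inter> I = {} \<and> I \<noteq> {} \<and> (\<forall>i\<in>I. \<forall>y\<in>I. (i, y) \<notin> E) \<and>
    card T + (if card S = 1 then 1 else 0) = card I \<and>
    (card S \<noteq> 1 \<longrightarrow> a \<in> S \<or> b \<in> S \<longrightarrow> a \<in> T \<or> b \<in> T)"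
proof (cases "\<exists>v. S = {v}")
  case True
  then obtain v where "S = {v}" by blast
  moreover have "(v, v) \<notin> E" using assms(2) by (simp add: irrefl_def)
  ultimately show ?thesis by (intro exI[of _ "{}"] exI[of _ "{v}"]) simp
next
  case False
  then obtain R l where c: "corona E S R l" using assms(3) by (auto simp: sun_def)
  have nz: "card S \<noteq> 1" using False by (auto simp: card_1_singleton_iff)
  have "S \<noteq> {}" using c by (auto simp: corona_def)
  then obtain u where u: "u \<in> S" "a \<in> S \<or> b \<in> S \<longrightarrow> u = a \<or> u = b" by blast
  obtain T I where TI: "S = T \<union> I" "T \<inter> I = {}" "u \<in> T" "card T = card I" "I \<noteq> {}"
    "\<And>i y. i \<in> I \<Longrightarrow> y \<in> I \<Longrightarrow> (i, y) \<notin> E"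
    using corona_split[OF assms(1,2) c u(1)] by metis
  have "a \<in> S \<or> b \<in> S \<longrightarrow> a \<in> T \<or> b \<in> T" using TI(3) u(2) by blast
  then show ?thesis using TI(1,2,4,5,6) nz by (intro exI[of _ T] exI[of _ I]) simp
qed

text \<open>The splits of all suns are united. With respect to \<open>E'\<close> the set
  \<open>I\<close> is isolated, and only the edge \<open>ab\<close> can spoil this for
  \<open>E\<close>. In that case neither end is in \<open>T\<close>, so an end in \<open>I\<close>
  is a one-vertex sun, whose gain pays for deleting the other end.\<close>

lemma many_suns_isolating_set:
  fixes E a b
  defines "E' \<equiv> E - {(a, b), (b, a)}"
  assumes "sym E" "irrefl E" "finite A" "m < card (suns E' A)"
  obtains T I where "T \<subseteq> A" "I \<subseteq> A" "T \<inter> I = {}" "card T \<le> card I" "m \<le> card I"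
    "\<And>i y. i \<in> I \<Longrightarrow> y \<in> A - T \<Longrightarrow> (i, y) \<notin> E"
proof -
  note result = that
  have E': "sym E'" "irrefl E'" using assms(2,3) by (auto simp: E'_def sym_def irrefl_def)
  let ?S = "suns E' A"
  define P where "P S T I \<longleftrightarrow> S = T \<union> I \<and> T \<inter> I = {} \<and> I \<noteq> {} \<and> (\<forall>i\<in>I. \<forall>y\<in>I. (i, y) \<notin> E') \<and>
    card T + (if card S = 1 then 1 else 0) = card I \<and>
    (card S \<noteq> 1 \<longrightarrow> a \<in> S \<or> b \<in> S \<longrightarrow> a \<in> T \<or> b \<in> T)" for S T I :: "'a set"
  have "\<exists>T I. P S T I" if "S \<in> ?S" for S
    using sun_split[OF E', of S a b] that by (simp add: P_def suns_def)
  then obtain fT fI where "\<And>S. S \<in> ?S \<Longrightarrow> P S (fT S) (fI S)" by metis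
  then have f: "S = fT S \<union> fI S" "fT S \<inter> fI S = {}" "fI S \<noteq> {}"
    "\<And>i y. i \<in> fI S \<Longrightarrow> y \<in> fI S \<Longrightarrow> (i, y) \<notin> E'"
    "card (fT S) + (if card S = 1 then 1 else 0) = card (fI S)"
    "card S \<noteq> 1 \<Longrightarrow> a \<in> S \<or> b \<in> S \<Longrightarrow> a \<in> fT S \<or> b \<in> fT S" if "S \<in> ?S" for S
    using that unfolding P_def by blast+
  have finS: "finite ?S" using assms(4) by (rule suns_finite)
  have subA: "S \<subseteq> A" if "S \<in> ?S" for S using that comps_subset by (auto simp: suns_def)
  have finf: "finite (fT S)" "finite (fI S)" if "S \<in> ?S" for S
    using f(1)[OF that] subA[OF that] assms(4) by (metis finite_Un finite_subset)+
  have dj: "S \<inter> S' = {}" if "S \<in> ?S" "S' \<in> ?S" "S \<noteq> S'" for S S'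
    using that comps_eqI[of S E' A S'] by (auto simp: suns_def)
  define T where "T = \<Union>(fT ` ?S)"
  define I where "I = \<Union>(fI ` ?S)"
  define N where "N = {S \<in> ?S. card S = 1}"
  have sub: "fT S \<subseteq> S" "fI S \<subseteq> S" if "S \<in> ?S" for S using f(1)[OF that] by auto
  have TIA: "T \<subseteq> A" "I \<subseteq> A" using sub subA unfolding T_def I_def by blast+
  have finTI: "finite T" "finite I" using finite_subset[OF _ assms(4)] TIA by auto
  have same: "S = S'" if "S \<in> ?S" "S' \<in> ?S" "x \<in> S" "x \<in> S'" for S S' x
    using dj that by blast
  have TI: "T \<inter> I = {}"
  proof (rule ccontr)
    assume "T \<inter> I \<noteq> {}"
    then obtain x S S' where x: "S \<in> ?S" "S' \<in> ?S" "x \<in> fT S" "x \<in> fI S'" by (auto simp: T_def I_def)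
    then have "S = S'" using same[of S S' x] sub by blast
    then show False using x f(2) by blast
  qed
  have cT: "card T = (\<Sum>S\<in>?S. card (fT S))"
    unfolding T_def
  proof (rule card_UN_disjoint)
    show "\<forall>S\<in>?S. \<forall>S'\<in>?S. S \<noteq> S' \<longrightarrow> fT S \<inter> fT S' = {}" using dj sub by blast
  qed (use finS finf in auto)
  have cI: "card I = (\<Sum>S\<in>?S. card (fI S))"
    unfolding I_def
  proof (rule card_UN_disjoint)
    show "\<forall>S\<in>?S. \<forall>S'\<in>?S. S \<noteq> S' \<longrightarrow> fI S \<inter> fI S' = {}" using dj sub by blast
  qed (use finS finf in auto)
  have "card T + card N = card I"
  proof -
    have "card N = (\<Sum>S\<in>?S. if card S = 1 then 1 else 0)"
      unfolding N_def using finS by (simp add: sum.If_cases Int_def)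
    then have "card T + card N = (\<Sum>S\<in>?S. card (fT S) + (if card S = 1 then 1 else 0))"
      using cT by (simp add: sum.distrib)
    also have "\<dots> = card I" unfolding cI by (rule sum.cong) (use f(5) in auto)
    finally show ?thesis .
  qed
  note cTN = this
  have cm: "m < card I"
  proof -
    have "1 \<le> card (fI S)" if "S \<in> ?S" for S
      using f(3)[OF that] finf(2)[OF that] by (simp add: Suc_le_eq card_gt_0_iff)
    then have "(\<Sum>S\<in>?S. 1) \<le> card I" unfolding cI by (intro sum_mono)
    then show ?thesis using assms(5) by simp
  qed
  have iso: "(i, y) \<notin> E'" if "i \<in> I" "y \<in> A - T" for i y
  proof
    assume e: "(i, y) \<in> E'"
    obtain S where S: "S \<in> ?S" "i \<in> fI S" using \<open>i \<in> I\<close> by (auto simp: I_def)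
    have "\<not> linked E' S (A - S)" using S(1) by (simp add: suns_def comps_def)
    then have "y \<in> S" using e S sub(2)[OF S(1)] that(2) by (auto simp: linked_def)
    then have "y \<in> fI S" using f(1)[OF S(1)] S(1) that(2) by (auto simp: T_def)
    then show False using f(4)[OF S(1) S(2)] e by blast
  qed
  have single: "{c} \<in> N" if "c \<in> I" "c = a \<or> c = b" "a \<notin> T" "b \<notin> T" for c
  proof -
    obtain S where S: "S \<in> ?S" "c \<in> fI S" using \<open>c \<in> I\<close> by (auto simp: I_def)
    have "c \<in> S" using S sub(2) by blast
    moreover have "a \<notin> fT S" "b \<notin> fT S" using that(3,4) S(1) by (auto simp: T_def)
    ultimately have "card S = 1" using f(6)[OF S(1)] that(2) by blast
    then have "S = {c}" using \<open>c \<in> S\<close> by (auto simp: card_1_singleton_iff)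
    then show ?thesis using S(1) \<open>card S = 1\<close> by (simp add: N_def)
  qed
  have finN: "finite N" using finS by (simp add: N_def)
  have bad: thesis if cd: "c \<in> I" "d \<in> A - T" "c \<noteq> d" "{c, d} = {a, b}" for c d
  proof -
    have ab: "a \<notin> T" "b \<notin> T" using cd TI by (auto simp: doubleton_eq_iff)
    have c: "{c} \<in> N" using single[OF cd(1) _ ab] cd(4) by blast
    have dT: "d \<notin> T" using cd(2) by simp
    have E: "E \<subseteq> E' \<union> {(c, d), (d, c)}" using cd(4) by (auto simp: E'_def doubleton_eq_iff)
    show thesis
    proof (rule result[of "insert d T" "I - {d}"])
      show "insert d T \<subseteq> A" "I - {d} \<subseteq> A" "insert d T \<inter> (I - {d}) = {}" using TIA cd(2) TI by auto
      \<comment> \<open>The number of suns exceeds \<open>m\<close> strictly, which absorbs the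
        possible loss of \<open>d\<close>.\<close>
      show "m \<le> card (I - {d})" using cm finTI by (auto simp: card_Diff_singleton_if)
      have ci: "card (insert d T) = card T + 1" using dT finTI by simp
      \<comment> \<open>Adding \<open>d\<close> to \<open>T\<close> costs one, covered by
        \<open>{c}\<close>. If \<open>d\<close> is also lost from \<open>I\<close>, then
        \<open>{d}\<close> is a second one-vertex sun and covers that.\<close>
      show "card (insert d T) \<le> card (I - {d})"
      proof (cases "d \<in> I")
        case True
        have "{d} \<in> N" using single[OF True _ ab] cd(4) by blast
        then have "card {{c}, {d}} \<le> card N" using c finN by (intro card_mono) auto
        then have "2 \<le> card N" using cd(3) by simp
        then show ?thesis using cTN ci True finTI by simp
      next
        case False
        have "card {{c}} \<le> card N" using c finN by (intro card_mono) auto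
        then show ?thesis using cTN ci False by simp
      qed
      show "(i, y) \<notin> E" if "i \<in> I - {d}" "y \<in> A - insert d T" for i y
        using iso[of i y] that E by auto
    qed
  qed
  show thesis
  proof (cases "\<exists>i\<in>I. \<exists>y\<in>A - T. (i, y) \<in> E")
    case True
    then obtain i y where iy: "i \<in> I" "y \<in> A - T" "(i, y) \<in> E" by blast
    then have "(i, y) \<in> {(a, b), (b, a)}" using iso[of i y] by (auto simp: E'_def)
    moreover have "i \<noteq> y" using iy(3) assms(3) by (auto simp: irrefl_def)
    ultimately show ?thesis using bad[OF iy(1,2)] by auto
  next
    case False
    then show ?thesis using that[of T I] TIA TI cTN cm by auto
  qed
qed

section \<open>Digraphs\<close>

text \<open>Connectedness of a digraph means strong connectedness of its symmetric closure. A walk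
  from \<open>T\<close> to its complement leaves \<open>T\<close> along some arc, and symmetry of
  \<open>G\<close> provides this arc in \<open>G\<close>.\<close>

lemma connected_cut_connected:
  assumes "graph G" "Digraph_Component.connected (del_verts G X)"
  shows "cut_connected (arcs_ends G) (verts G - X)"
proof -
  interpret graph G by fact
  let ?H = "mk_symmetric (del_verts G X)"
  let ?V = "verts G - X"
  have V: "verts (with_proj ?H) = ?V" by (simp add: mk_symmetric_def del_verts_def)
  have ae: "arcs_ends (with_proj ?H) \<subseteq> arcs_ends G \<inter> ?V \<times> ?V"
  proof -
    have "(head G e, tail G e) \<in> arcs_ends G" if "e \<in> arcs G" for e
      using that graph_symmetric[of "tail G e" "head G e"] by (auto simp: arcs_ends_conv)
    then show ?thesis
      by (auto simp: mk_symmetric_def del_verts_def arcs_ends_conv)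
  qed
  have sc: "strongly_connected (with_proj ?H)" using assms(2) by (simp add: connected_def)
  show ?thesis
    unfolding cut_connected_def
  proof (intro conjI allI impI)
    show "?V \<noteq> {}" using sc V by (auto simp: strongly_connected_def)
    fix T assume T: "T \<subset> ?V" "T \<noteq> {}"
    then obtain u v where uv: "u \<in> T" "v \<in> ?V" "v \<notin> T" by blast
    have "u \<rightarrow>\<^sup>*\<^bsub>with_proj ?H\<^esub> v" using sc V uv T by (auto simp: strongly_connected_def)
    then have "(u, v) \<in> (arcs_ends (with_proj ?H))\<^sup>*" by (rule reachable_rtranclI)
    then have "\<exists>x y. x \<in> T \<and> y \<notin> T \<and> (x, y) \<in> arcs_ends (with_proj ?H)"
      using uv(1,3) by (induction rule: rtrancl_induct) auto
    then show "linked (arcs_ends G) T (?V - T)" using ae unfolding linked_def by blast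
  qed
qed

lemma path_reachable:
  assumes "sym E" "\<And>i. Suc i < length p \<Longrightarrow> (p ! i, p ! Suc i) \<in> E" "i < length p" "j < length p"
  shows "(p ! i, p ! j) \<in> E\<^sup>*"
proof -
  have 0: "(p ! 0, p ! k) \<in> E\<^sup>*" if "k < length p" for k
    using that
  proof (induction k)
    case (Suc k)
    then show ?case using assms(2)[of k] by (meson Suc_lessD rtrancl.rtrancl_into_rtrancl)
  qed simp
  have "sym (E\<^sup>*)" using assms(1) by (rule sym_rtrancl)
  then have "(p ! i, p ! 0) \<in> E\<^sup>*" using 0[OF assms(3)] by (rule symD)
  then show ?thesis using 0[OF assms(4)] by (rule rtrancl_trans)
qed

definition path_edges :: "'a list \<Rightarrow> 'a set set" where
  "path_edges p = {{p ! i, p ! Suc i} | i. Suc i < length p}"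

lemma path_edges_subset: "e \<in> path_edges p \<Longrightarrow> e \<subseteq> set p"
  by (auto simp: path_edges_def)

text \<open>The condition \<open>Q\<close> sees only the unordered pair of ends, so opposite arcs
  are kept or dropped together.\<close>

lemma graph_restrict_arcs:
  assumes "graph G"
  shows "graph (G\<lparr>arcs := {a \<in> arcs G. Q {tail G a, head G a}}\<rparr>)" (is "graph ?F")
proof -
  interpret G: graph G by fact
  interpret wf_digraph ?F by unfold_locales auto
  have "symmetric ?F"
    unfolding symmetric_conv
  proof
    fix e assume e: "e \<in> arcs ?F"
    then obtain e' where e': "e' \<in> arcs G" "tail G e = head G e'" "head G e = tail G e'"
      using G.sym_arcs by (auto simp: symmetric_conv)
    then have "e' \<in> arcs ?F" using e by (simp add: insert_commute)
    then show "\<exists>e2\<in>arcs ?F. tail ?F e = head ?F e2 \<and> head ?F e = tail ?F e2"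
      using e' by (intro bexI[of _ e']) simp_all
  qed
  then show ?thesis
    by unfold_locales (auto simp: arc_to_ends_def intro: G.no_multi_arcs dest: G.no_loops)
qed

text \<open>The factor keeps the arcs between consecutive vertices of a path in \<open>P\<close>. No
  such arc leaves its path, and each path is strongly connected by symmetry, so the strong
  components are the paths.\<close>

lemma path_partition_imp_P_ge_factor:
  assumes "graph H" "path_partition (arcs_ends H) (verts H) P"
  shows "\<exists>F. P_ge_factor 3 F H"
proof -
  interpret H: graph H by fact
  define F where "F = H\<lparr>arcs := {a \<in> arcs H. \<exists>p\<in>P. {tail H a, head H a} \<in> path_edges p}\<rparr>"
  have F: "verts F = verts H" "tail F = tail H" "head F = head H"
    "arcs F = {a \<in> arcs H. \<exists>p\<in>P. {tail H a, head H a} \<in> path_edges p}"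
    by (auto simp: F_def)
  have P: "\<And>p. p \<in> P \<Longrightarrow> distinct p" "\<And>p. p \<in> P \<Longrightarrow> 3 \<le> length p"
    "\<And>p q. p \<in> P \<Longrightarrow> q \<in> P \<Longrightarrow> set p \<inter> set q \<noteq> {} \<Longrightarrow> p = q" "\<Union>(set ` P) = verts H"
    using assms(2) unfolding path_partition_def is_path_def by blast+
  have Pe: "(p ! i, p ! Suc i) \<in> arcs_ends H" if "p \<in> P" "Suc i < length p" for p i
    using assms(2) that unfolding path_partition_def is_path_def
    by (simp add: successively_conv_nth)
  have gF: "graph F" unfolding F_def by (rule graph_restrict_arcs[OF assms(1)])
  interpret F: graph F by (rule gF)
  have Fe: "(p ! i, p ! Suc i) \<in> arcs_ends F" if pi: "p \<in> P" "Suc i < length p" for p i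
  proof -
    obtain e where e: "e \<in> arcs H" "tail H e = p ! i" "head H e = p ! Suc i"
      using Pe[OF pi] by (auto simp: arcs_ends_conv)
    then have "e \<in> arcs F" using pi by (auto simp: F path_edges_def)
    then show ?thesis using e by (force simp: arcs_ends_conv F)
  qed
  have stay: "v \<in> set p" if uv: "(u, v) \<in> arcs_ends F" "u \<in> set p" "p \<in> P" for u v p
  proof -
    obtain e q where e: "tail H e = u" "head H e = v" "q \<in> P" "{u, v} \<in> path_edges q"
      using uv(1) by (auto simp: arcs_ends_conv F)
    then have q: "u \<in> set q" "v \<in> set q" using path_edges_subset[OF e(4)] by auto
    then have "q = p" using P(3)[OF e(3) uv(3)] uv(2) by blast
    then show ?thesis using q by simp
  qed
  have scc: "path_graph C" "3 \<le> card (verts C)" if C: "C \<in> F.sccs" for C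
  proof -
    have ind: "induced_subgraph C F" and sc: "strongly_connected C"
      and mx: "\<And>C'. induced_subgraph C' F \<Longrightarrow> strongly_connected C' \<Longrightarrow> \<not> verts C \<subset> verts C'"
      using C by (auto simp: F.sccs_def)
    have CF: "verts C \<subseteq> verts F" "tail C = tail H" "head C = head H"
      "arcs C = {e \<in> arcs F. tail F e \<in> verts C \<and> head F e \<in> verts C}"
      using ind by (auto simp: induced_subgraph_def subgraph_def compatible_def F)
    have aeC: "arcs_ends C \<subseteq> arcs_ends F" using CF by (auto simp: arcs_ends_conv F)
    obtain v where v: "v \<in> verts C" using sc by (auto simp: strongly_connected_def)
    then obtain p where p: "p \<in> P" "v \<in> set p" using CF(1) P(4) by (auto simp: F)
    have sub: "verts C \<subseteq> set p"
    proof
      fix u assume "u \<in> verts C"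
      then have "v \<rightarrow>\<^sup>*\<^bsub>C\<^esub> u" using sc v by (auto simp: strongly_connected_def)
      then have "(v, u) \<in> (arcs_ends C)\<^sup>*" by (rule reachable_rtranclI)
      then show "u \<in> set p" using p(2)
        by (induction rule: rtrancl_induct) (use stay[OF _ _ p(1)] aeC in blast)+
    qed
    have pF: "set p \<subseteq> verts F" using P(4) p(1) by (auto simp: F)
    let ?C = "F \<restriction> set p"
    have indC: "induced_subgraph ?C F" using pF by (rule F.induced_induce)
    interpret C': sym_digraph ?C using indC by (rule F.induced_graph_imp_graph)
    have "strongly_connected ?C"
    proof (rule strongly_connectedI)
      show "verts ?C \<noteq> {}" using p(2) by auto
      fix x y assume "x \<in> verts ?C" "y \<in> verts ?C"
      then obtain i j where ij: "i < length p" "j < length p" "x = p ! i" "y = p ! j"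
        by (auto simp: in_set_conv_nth)
      have "(p ! i, p ! Suc i) \<in> arcs_ends ?C" if "Suc i < length p" for i
      proof -
        have "p ! i \<in> set p" "p ! Suc i \<in> set p" using that by auto
        then show ?thesis using Fe[OF p(1) that] by (force simp: arcs_ends_conv)
      qed
      then have "(x, y) \<in> (arcs_ends ?C)\<^sup>*"
        unfolding ij(3,4) using C'.sym_arcs ij(1,2) by (intro path_reachable) (auto simp: symmetric_def)
      then show "x \<rightarrow>\<^sup>*\<^bsub>?C\<^esub> y" using \<open>x \<in> verts ?C\<close> C'.reachable_conv' by blast
    qed
    then have vC: "verts C = set p" using mx[OF indC] sub by auto
    show "3 \<le> card (verts C)" using vC P(1,2)[OF p(1)] by (simp add: distinct_card)
    have "edges C = path_edges p"
    proof
      show "edges C \<subseteq> path_edges p"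
      proof
        fix e assume "e \<in> edges C"
        then obtain a q where a: "a \<in> arcs C" "e = {tail H a, head H a}" "q \<in> P" "e \<in> path_edges q"
          using CF by (auto simp: edges_def F)
        have "tail H a \<in> set p" using a(1) CF(4) vC by (auto simp: F)
        moreover have "tail H a \<in> set q" using path_edges_subset[OF a(4)] a(2) by auto
        ultimately have "q = p" using P(3)[OF a(3) p(1)] by blast
        then show "e \<in> path_edges p" using a(4) by simp
      qed
      show "path_edges p \<subseteq> edges C"
      proof
        fix e assume "e \<in> path_edges p"
        then obtain i where i: "Suc i < length p" "e = {p ! i, p ! Suc i}" by (auto simp: path_edges_def)
        obtain a where a: "a \<in> arcs F" "tail H a = p ! i" "head H a = p ! Suc i"
          using Fe[OF p(1) i(1)] by (auto simp: arcs_ends_conv F(2,3))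
        then have "a \<in> arcs C" using CF(4) vC i(1) by (auto simp: F)
        then show "e \<in> edges C" unfolding edges_def using a i CF by force
      qed
    qed
    moreover have "graph C"
      using F.digraphI_induced[OF ind] F.induced_graph_imp_graph[OF ind]
      by (simp add: graph_def pseudo_graph_def digraph_def)
    ultimately show "path_graph C"
      unfolding path_graph_def using vC P(1,2)[OF p(1)] p(2)
      by (intro conjI exI[of _ p]) (auto simp: path_edges_def)
  qed
  have "spanning F H" using F.wf_digraph H.wf_digraph by (auto simp: spanning_def subgraph_def compatible_def F)
  moreover have "2 \<le> card (verts C)" if "C \<in> F.sccs" for C using scc(2)[OF that] by linarith
  ultimately have "P_ge_factor 3 F H"
    using gF scc by (simp add: P_ge_factor_def path_factor_def)
  then show ?thesis by blast
qed

section \<open>Isolated toughness\<close>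

lemma card_le_num_isolated:
  assumes "graph G" "I \<subseteq> verts G - D" "\<And>i y. i \<in> I \<Longrightarrow> y \<in> verts G - D \<Longrightarrow> (i, y) \<notin> arcs_ends G"
  shows "card I \<le> num_isolated (del_verts G D)"
proof -
  interpret graph G by fact
  let ?H = "del_verts G D"
  have "in_arcs ?H i = {} \<and> out_arcs ?H i = {}" if i: "i \<in> I" for i
  proof -
    have "(i, y) \<notin> arcs_ends G" "(y, i) \<notin> arcs_ends G" if "y \<in> verts G - D" for y
      using assms(3)[OF i that] graph_symmetric by blast+
    then show ?thesis by (auto simp: in_arcs_def out_arcs_def del_verts_def arcs_ends_conv)
  qed
  then have "I \<subseteq> {v \<in> verts ?H. in_arcs ?H v = {} \<and> out_arcs ?H v = {}}"
    using assms(2) by (auto simp: del_verts_def)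
  then show ?thesis unfolding num_isolated_def by (intro card_mono) (auto simp: del_verts_def)
qed

text \<open>Two vertices isolated by the deletion of \<open>D\<close> are not adjacent, so
  \<open>G\<close> is not complete. The toughness is then a minimum of finitely many ratios, one of
  which belongs to \<open>D\<close>.\<close>

lemma isolated_toughness_bound:
  assumes "graph G" "ereal t < isolated_toughness G" "D \<subseteq> verts G" "2 \<le> num_isolated (del_verts G D)"
  shows "t * real (num_isolated (del_verts G D)) < real (card D)"
proof -
  interpret graph G by fact
  let ?i = "\<lambda>X. num_isolated (del_verts G X)"
  have "\<not> complete_graph G"
  proof
    assume c: "complete_graph G"
    let ?I = "{v \<in> verts (del_verts G D). in_arcs (del_verts G D) v = {} \<and> out_arcs (del_verts G D) v = {}}"
    have "2 \<le> card ?I" using assms(4) by (simp only: num_isolated_def)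
    then obtain A where "A \<subseteq> ?I" "card A = 2" by (rule obtain_subset_with_card_n)
    then obtain u v where uv: "u \<in> ?I" "v \<in> ?I" "u \<noteq> v" by (auto simp: card_2_iff)
    then have "(u, v) \<in> arcs_ends G"
      using c by (auto simp: complete_graph_def complete_digraph_def del_verts_def)
    then obtain e where "e \<in> arcs G" "tail G e = u" "head G e = v" by (auto simp: arcs_ends_conv)
    then have "e \<in> out_arcs (del_verts G D) u" using uv by (auto simp: out_arcs_def del_verts_def)
    then show False using uv by blast
  qed
  then have "isolated_toughness G = Min {ereal (real (card X) / real (?i X)) | X. X \<subseteq> verts G \<and> 2 \<le> ?i X}"
    by (simp add: isolated_toughness_def)
  also have "\<dots> \<le> ereal (real (card D) / real (?i D))"
  proof (rule Min_le)
    have "{ereal (real (card X) / real (?i X)) | X. X \<subseteq> verts G \<and> 2 \<le> ?i X}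
        \<subseteq> (\<lambda>X. ereal (real (card X) / real (?i X))) ` Pow (verts G)" by auto
    then show "finite {ereal (real (card X) / real (?i X)) | X. X \<subseteq> verts G \<and> 2 \<le> ?i X}"
      by (rule finite_subset) simp
  qed (use assms(3,4) in auto)
  finally have "ereal t < ereal (real (card D) / real (?i D))" using assms(2) by (rule less_le_trans[rotated])
  then show ?thesis using assms(4) by (simp add: pos_less_divide_eq)
qed

text \<open>Here \<open>q = r + 2\<close>, \<open>x = card X\<close>, \<open>i\<close> counts
  isolated vertices and \<open>c\<close> deleted ones. Clearing denominators gives
  \<open>(n + q) * i < 2 * q * (n + x)\<close>. With \<open>2 * x \<le> i\<close> this becomes
  \<open>n * x < n * q\<close>, against \<open>q \<le> x\<close>.\<close>

lemma tough_count:
  fixes n q x i c :: nat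
  assumes "(real n + 3 * real q) / (2 * real q) * real i < real c" "c \<le> n + x + i" "2 * x \<le> i" "q \<le> x" "0 < q"
  shows False
proof -
  have "(real n + 3 * real q) * real i < 2 * real q * real c"
    using assms(1,5) by (simp add: field_simps)
  also have "\<dots> \<le> 2 * real q * (real n + real x + real i)"
    using assms(2) by (intro mult_left_mono) auto
  finally have "(real n + real q) * real i < 2 * real q * (real n + real x)" by (simp add: algebra_simps)
  moreover have "(real n + real q) * (2 * real x) \<le> (real n + real q) * real i"
    using assms(3) by (intro mult_left_mono) auto
  ultimately have "real n * real x < real n * real q" by (simp add: algebra_simps)
  then show False using assms(4) by (simp add: mult_less_cancel_left)
qed

section \<open>Kaneko's condition after deleting \<open>W\<close> and an edge\<close>

lemma edgesE:
  assumes "graph G" "e \<in> edges (del_verts G W)"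
  obtains a b where "e = {a, b}" "a \<noteq> b" "a \<in> verts G - W" "b \<in> verts G - W"
proof -
  interpret graph G by fact
  obtain x where "x \<in> arcs (del_verts G W)" "e = {tail G x, head G x}"
    using assms(2) by (auto simp: edges_def del_verts_def)
  then show ?thesis using that[of "tail G x" "head G x"] no_loops[of x] by (auto simp: del_verts_def)
qed

text \<open>Deleting \<open>W\<close> uses up \<open>n\<close> of the connectivity, so the rest
  handles the sets \<open>X\<close> with fewer than \<open>r + 2\<close> vertices; toughness handles
  the larger ones.\<close>

lemma deleted_edge_sun_bounded:
  fixes n r :: nat
  assumes "graph G" "k_connected (n + r + 2) G"
    and tough: "isolated_toughness G > ereal ((real n + 3 * (real r + 2)) / (2 * (real r + 2)))"
    and W: "W \<subseteq> verts G" "card W = n"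
    and ab: "a \<noteq> b" "a \<in> verts G - W" "b \<in> verts G - W"
  shows "sun_bounded (arcs_ends G - {(a, b), (b, a)}) (verts G - W)"
proof (rule ccontr)
  interpret graph G by fact
  define E where "E = arcs_ends G"
  define V where "V = verts G - W"
  let ?E = "E - {(a, b), (b, a)}"
  have E: "sym E" "irrefl E"
    using sym_arcs no_loops by (auto simp: E_def symmetric_def irrefl_def arcs_ends_conv)
  have finV: "finite V" by (simp add: V_def)
  have finW: "finite W" using W(1) finite_verts finite_subset by blast
  have conn: "cut_connected E (V - X)" if "X \<subseteq> V" "card X < r + 2" for X
  proof -
    have "card (W \<union> X) < n + r + 2" using card_Un_le[of W X] W(2) that(2) by linarith
    moreover have "W \<union> X \<subseteq> verts G" using W(1) that(1) by (auto simp: V_def)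
    ultimately have "Digraph_Component.connected (del_verts G (W \<union> X))"
      using assms(2) by (simp add: k_connected_def)
    then have "cut_connected E (verts G - (W \<union> X))"
      unfolding E_def by (rule connected_cut_connected[OF assms(1)])
    moreover have "verts G - (W \<union> X) = V - X" by (auto simp: V_def)
    ultimately show ?thesis by simp
  qed
  assume "\<not> sun_bounded (arcs_ends G - {(a, b), (b, a)}) (verts G - W)"
  then obtain X where X: "X \<subseteq> V" "2 * card X < card (suns ?E (V - X))"
    by (auto simp: sun_bounded_def E_def V_def not_le)
  have finX: "finite X" using X(1) finV finite_subset by blast
  consider (empty) "X = {}" | (small) "X \<noteq> {}" "card X < r + 2" | (large) "r + 2 \<le> card X" by linarith
  then show False
  proof cases
    \<comment> \<open>A sun of \<open>V\<close> forces a vertex \<open>l\<close> with no neighbour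
      other than \<open>p\<close>. But \<open>V - {p}\<close> is connected and contains more than
      \<open>l\<close>, as \<open>V\<close> has at least three vertices.\<close>
    case empty
    then obtain S where S: "S \<in> suns ?E V" using X(2) by fastforce
    obtain l p where lp: "l \<in> V" "p \<in> V" "l \<noteq> p" "\<And>y. y \<in> V \<Longrightarrow> (l, y) \<in> E \<Longrightarrow> y = p"
      using deleted_edge_sun_leaf[OF E(2) _ _ ab(1) S] ab(2,3) unfolding V_def by metis
    have "card V = card (verts G) - n" using W finW by (simp add: V_def card_Diff_subset)
    moreover have "n + r + 2 < card (verts G)" using assms(2) by (simp add: k_connected_def)
    ultimately have "3 \<le> card V" by linarith
    then have "V \<noteq> {l, p}" using lp(3) by auto
    then have "{l} \<subset> V - {p}" using lp by auto
    moreover have "cut_connected E (V - {p})" using lp(2) by (intro conn) auto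
    ultimately have "linked E {l} (V - {p} - {l})" by (auto simp: cut_connected_def)
    then show False using lp(4) by (auto simp: linked_def)
  next
    \<comment> \<open>The set \<open>V - X\<close> is connected before the deletion of the edge and
      so has at most two components after it, whereas a violation at a nonempty \<open>X\<close>
      needs three suns.\<close>
    case small
    have c: "comps E (V - X) = {V - X}" using conn[OF X(1) small(2)] by (rule comps_connected)
    have fin: "finite (comps ?E (V - X))" using finV by (simp add: comps_finite)
    have "card (comps ?E (V - X)) \<le> 2"
    proof (cases "\<exists>S\<in>comps ?E (V - X). a \<notin> S \<and> b \<notin> S")
      case True
      then obtain S where S: "S \<in> comps ?E (V - X)" "a \<notin> S" "b \<notin> S" by blast
      then have "S = V - X" using comps_delete_edge[of S E a b] c by blast
      then have "comps ?E (V - X) \<subseteq> {S}"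
        using comps_eqI[OF _ S(1)] comps_subset comps_nonempty by fastforce
      then have "card (comps ?E (V - X)) \<le> card {S}" by (intro card_mono) auto
      then show ?thesis by simp
    next
      case False
      then have "comps ?E (V - X) = {S \<in> comps ?E (V - X). a \<in> S \<or> b \<in> S}" by blast
      then show ?thesis using card_comps_containing[of "V - X" ?E a b] finV by simp
    qed
    moreover have "card (suns ?E (V - X)) \<le> card (comps ?E (V - X))"
      using fin suns_comps by (rule card_mono)
    moreover have "card X \<noteq> 0" using small(1) finX by simp
    ultimately show False using X(2) by linarith
  next
    \<comment> \<open>The number \<open>?i\<close> of isolated vertices may exceed
      \<open>card I\<close>; the estimates for \<open>card D\<close> and \<open>2 * card X\<close>
      persist with \<open>?i\<close> in its place.\<close>
    case large
    obtain T I where TI: "T \<subseteq> V - X" "I \<subseteq> V - X" "T \<inter> I = {}" "card T \<le> card I" "2 * card X \<le> card I"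
      "\<And>i y. i \<in> I \<Longrightarrow> y \<in> V - X - T \<Longrightarrow> (i, y) \<notin> E"
      using many_suns_isolating_set[OF E _ X(2)] finV by (metis finite_Diff)
    define D where "D = W \<union> X \<union> T"
    have DV: "verts G - D = V - X - T" by (auto simp: D_def V_def)
    let ?i = "num_isolated (del_verts G D)"
    have I: "card I \<le> ?i"
      by (rule card_le_num_isolated[OF assms(1)]) (use TI DV in \<open>auto simp: E_def\<close>)
    have "D \<subseteq> verts G" using W(1) X(1) TI(1) by (auto simp: D_def V_def)
    moreover have "2 \<le> ?i" using I TI(5) large by linarith
    ultimately have "(real n + 3 * (real r + 2)) / (2 * (real r + 2)) * real ?i < real (card D)"
      by (intro isolated_toughness_bound[OF assms(1) tough])
    then have "(real n + 3 * real (r + 2)) / (2 * real (r + 2)) * real ?i < real (card D)"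
      by (simp only: of_nat_add of_nat_numeral)
    moreover have "card D \<le> n + card X + ?i"
    proof -
      have "card D \<le> card W + card X + card T"
        unfolding D_def by (meson add_le_mono1 card_Un_le le_trans)
      then show ?thesis using TI(4) I W(2) by linarith
    qed
    ultimately show False by (rule tough_count) (use I TI(5) large in auto)
  qed
qed

lemma graph_del_verts: "graph G \<Longrightarrow> graph (del_verts G W)"
proof -
  assume "graph G"
  then interpret graph G .
  have "induced_subgraph (del_verts G W) G" unfolding del_verts_def by (rule induced_induce) blast
  then show ?thesis
    using digraphI_induced induced_graph_imp_graph by (simp add: graph_def pseudo_graph_def digraph_def)
qed

lemma graph_del_edge: "graph G \<Longrightarrow> graph (del_edge G e)"
  unfolding del_edge_def by (rule graph_restrict_arcs)

theorem theorem8: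
  fixes n r :: nat and G :: "('a,'b) pre_digraph"
  assumes "graph G"
    and "k_connected (n + r + 2) G"
    and "isolated_toughness G > ereal ((real n + 3 * (real r + 2)) / (2 * (real r + 2)))"
  shows "factor_critical_avoidable 3 n G \<and>
    (\<forall>W \<subseteq> verts G. card W = n \<longrightarrow>
       (\<forall>e \<in> edges (del_verts G W). \<exists>F. P_ge_factor 3 F (del_edge (del_verts G W) e)))"
proof -
  interpret graph G by fact
  have factor: "\<exists>F. P_ge_factor 3 F (del_edge (del_verts G W) e)"
    if W: "W \<subseteq> verts G" "card W = n" and e: "e \<in> edges (del_verts G W)" for W e
  proof -
    let ?H = "del_edge (del_verts G W) e"
    obtain a b where ab: "e = {a, b}" "a \<noteq> b" "a \<in> verts G - W" "b \<in> verts G - W"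
      using edgesE[OF assms(1) e] by metis
    let ?E = "arcs_ends G - {(a, b), (b, a)}"
    have "p3_factorable ?E (verts G - W)"
    proof (rule sun_bounded_factorable)
      show "sym ?E" using sym_arcs by (auto simp: symmetric_def sym_def)
      show "irrefl ?E" using no_loops by (auto simp: irrefl_def arcs_ends_conv)
      show "finite ?E" by (simp add: arcs_ends_conv)
      show "sun_bounded ?E (verts G - W)" by (rule deleted_edge_sun_bounded[OF assms W ab(2-4)])
    qed simp
    then obtain P where P: "path_partition ?E (verts G - W) P" by (auto simp: p3_factorable_def)
    \<comment> \<open>For \<open>u\<close> and \<open>v\<close> outside \<open>W\<close>, removing
      the ordered pairs \<open>(a, b)\<close> and \<open>(b, a)\<close> amounts to removing all arcs
      whose set of ends is \<open>e\<close>.\<close>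
    have ends: "(u, v) \<in> arcs_ends ?H" if "(u, v) \<in> ?E" "u \<in> verts G - W" "v \<in> verts G - W" for u v
      using that ab(1) by (auto simp: arcs_ends_conv del_edge_def del_verts_def image_iff doubleton_eq_iff)
    have "is_path (arcs_ends ?H) p" if p: "p \<in> P" for p
    proof -
      have pV: "set p \<subseteq> verts G - W" and pp: "is_path ?E p" using P p by (auto simp: path_partition_def)
      have "successively (\<lambda>x y. (x, y) \<in> arcs_ends ?H) p"
      proof (rule successively_mono[of "\<lambda>x y. (x, y) \<in> ?E"])
        show "successively (\<lambda>x y. (x, y) \<in> ?E) p" using pp by (simp add: is_path_def)
        show "(x, y) \<in> arcs_ends ?H" if "x \<in> set p" "y \<in> set p" "(x, y) \<in> ?E" for x y
          by (rule ends) (use that pV in blast)+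
      qed
      then show ?thesis using pp by (simp add: is_path_def)
    qed
    then have "path_partition (arcs_ends ?H) (verts ?H) P"
      using P by (simp add: path_partition_def del_edge_def del_verts_def)
    then show ?thesis
      by (intro path_partition_imp_P_ge_factor graph_del_edge graph_del_verts assms(1))
  qed
  \<comment> \<open>A factor of the graph without \<open>e\<close> is also spanning in the graph
    with \<open>e\<close>, and it avoids \<open>e\<close>; so the first conjunct follows from the
    second.\<close>
  have "\<exists>F. P_ge_factor 3 F (del_verts G W) \<and> e \<notin> edges F"
    if W: "W \<subseteq> verts G" "card W = n" and e: "e \<in> edges (del_verts G W)" for W e
  proof -
    let ?K = "del_verts G W"
    obtain F where F: "P_ge_factor 3 F (del_edge ?K e)" using factor[OF W e] by blast
    then have sp: "spanning F (del_edge ?K e)" by (simp add: P_ge_factor_def path_factor_def)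
    have "wf_digraph ?K" unfolding del_verts_def by (rule wellformed_induce_subgraph)
    then have "spanning F ?K" using sp by (auto simp: spanning_def subgraph_def compatible_def del_edge_def)
    then have "P_ge_factor 3 F ?K" using F by (simp add: P_ge_factor_def path_factor_def)
    moreover have "e \<notin> edges F"
      using sp by (auto simp: spanning_def subgraph_def compatible_def del_edge_def edges_def)
    ultimately show ?thesis by blast
  qed
  then show ?thesis
    using factor unfolding factor_critical_avoidable_def factor_avoidable_def by blast
qed

end
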